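(* Let $\alpha>0$, $0<p,q\le\infty$, $\sigma\in\mathbb R$, and let $\Sigma\subset\mathbb C$ be separated. Suppose that $(\phi_\xi)_{\xi\in\Sigma}$ is a rapidly Fock localized family of entire functions. Then the synthesis operator $$S_\Sigma^\phi:\ell_{\mathrm{nat};\sigma}^{p,q}(\Sigma)\longrightarrow\mathcal F_{\alpha;\sigma}^{p,q},\qquad S_\Sigma^\phi c:=\sum_{\xi\in\Sigma}c_\xi\phi_\xi,$$ is well defined and bounded: the defining series converges absolutely and locally uniformly on $\mathbb C$, and there is a constant $C>0$, depending only on $\alpha,p,q,\sigma$, the separation data of $\Sigma$ and the localization constants of $(\phi_\xi)_{\xi\in\Sigma}$, such that $$\|S_\Sigma^\phi c\|_{\mathcal F_{\alpha;\sigma}^{p,q}}\le C\|c\|_{\ell_{\mathrm{nat};\sigma}^{p,q}(\Sigma)},\qquad c\in\ell_{\mathrm{nat};\sigma}^{p,q}(\Sigma).$$ If $q=\infty$ and $c\in\ell_{\mathrm{nat};\sigma,0}^{p,\infty}(\Sigma)$, then $$(1+r)^\sigma M_p(S_\Sigma^\phi c,r)e^{-\frac\alpha2r^2}\longrightarrow0\qquad(r\to\infty).$$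
   Context: Convention: $1/\infty=0$. For an entire function $f$ and $r\ge0$, $M_p(f,r):=\left(\frac1{2\pi}\int_0^{2\pi}|f(re^{i\theta})|^p\,d\theta\right)^{1/p}$ if $0<p<\infty$ and $M_\infty(f,r):=\sup_\theta|f(re^{i\theta})|$. For $\sigma\in\mathbb R$, $\mathcal F_{\alpha;\sigma}^{p,q}$ is the space of entire functions with finite (quasi-)norm $\|f\|_{\mathcal F_{\alpha;\sigma}^{p,q}}:=\left(\alpha q\int_0^\infty[M_p(f,r)(1+r)^\sigma]^qe^{-\frac{\alpha q}2r^2}r\,dr\right)^{1/q}$ if $0<q<\infty$, and $\|f\|_{\mathcal F_{\alpha;\sigma}^{p,\infty}}:=\sup_{r\ge0}M_p(f,r)e^{-\frac\alpha2r^2}(1+r)^\sigma$. A set $\Sigma\subset\mathbb C$ is separated if $\inf_{\xi\ne\eta\in\Sigma}|\xi-\eta|>0$. A family $(\phi_\xi)_{\xi\in\Sigma}$ of entire functions is rapidly Fock localized if for every $N>0$ there is $C_N>0$ with $|\phi_\xi(z)|e^{-\frac\alpha2|z|^2}\le C_N(1+|z-\xi|)^{-N}$ for all $z\in\mathbb C$, $\xi\in\Sigma$ (the $C_N$ are the localization constants). Let $A_m:=\{z\in\mathbb C:m\le|z|<m+1\}$ and $\Sigma_m:=\Sigma\cap A_m$, $m=0,1,2,\dots$. For $\nu\in\mathbb R$, $\ell_{w_\nu}^{p,q}(\Sigma)$ is the space of complex sequences $c=(c_\xi)_{\xi\in\Sigma}$ with $\|c\|_{\ell_{w_\nu}^{p,q}(\Sigma)}:=\left\|\left((1+m)^\nu\|c|_{\Sigma_m}\|_{\ell^p(\Sigma_m)}\right)_{m\ge0}\right\|_{\ell^q}<\infty$,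 and $\ell_{w_\nu,0}^{p,\infty}(\Sigma)$ is the subspace of those $c\in\ell_{w_\nu}^{p,\infty}(\Sigma)$ with $(1+m)^\nu\|c|_{\Sigma_m}\|_{\ell^p(\Sigma_m)}\to0$ as $m\to\infty$. Put $\ell_{\mathrm{nat};\sigma}^{p,q}(\Sigma):=\ell_{w_\nu}^{p,q}(\Sigma)$ with $\nu=\frac1q-\frac1p+\sigma$, and $\ell_{\mathrm{nat};\sigma,0}^{p,\infty}(\Sigma):=\ell_{w_\nu,0}^{p,\infty}(\Sigma)$ with $\nu=-\frac1p+\sigma$. *)

theory Defs
  imports "HOL-Analysis.Analysis"
begin

text \<open>
  Exponents \<open>p, q\<close> with \<open>0 < p, q \<le> \<infinity>\<close> are elements of \<^typ>\<open>ennreal\<close>; the convention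
  \<open>1/\<infinity> = 0\<close> is then the library's. All means and (quasi-)norms take values in \<^typ>\<open>ennreal\<close>,
  so that they are defined for every argument, and the spaces consist of the arguments of
  finite norm.
\<close>

definition recip :: "ennreal \<Rightarrow> real" where
  "recip p = enn2real (1 / p)"

text \<open>The power \<open>x\<^sup>a\<close>, intended for exponents \<open>a > 0\<close> only.\<close>

definition epow :: "ennreal \<Rightarrow> real \<Rightarrow> ennreal" where
  "epow x a = (if x = \<infinity> then \<infinity> else ennreal (enn2real x powr a))"


subsection \<open>Mixed norm Fock spaces\<close>

definition circle_mean :: "ennreal \<Rightarrow> (complex \<Rightarrow> complex) \<Rightarrow> real \<Rightarrow> ennreal" where
  "circle_mean p f r =
     (if p = \<infinity> then (SUP \<theta>. ennreal (cmod (f (rcis r \<theta>))))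
      else epow (ennreal (1 / (2 * pi)) *
             (\<integral>\<^sup>+\<theta>\<in>{0..2 * pi}. epow (ennreal (cmod (f (rcis r \<theta>)))) (enn2real p) \<partial>lborel))
           (recip p))"

definition fock_norm ::
    "real \<Rightarrow> real \<Rightarrow> ennreal \<Rightarrow> ennreal \<Rightarrow> (complex \<Rightarrow> complex) \<Rightarrow> ennreal" where
  "fock_norm \<alpha> \<sigma> p q f =
     (if q = \<infinity> then
        (SUP r\<in>{0..}. circle_mean p f r * ennreal (exp (- (\<alpha> / 2) * r\<^sup>2) * (1 + r) powr \<sigma>))
      else
        epow (ennreal (\<alpha> * enn2real q) *
          (\<integral>\<^sup>+r\<in>{0..}. epow (circle_mean p f r * ennreal ((1 + r) powr \<sigma>)) (enn2real q) *
                       ennreal (exp (- (\<alpha> * enn2real q / 2) * r\<^sup>2) * r) \<partial>lborel))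
        (recip q))"

definition fock_space ::
    "real \<Rightarrow> real \<Rightarrow> ennreal \<Rightarrow> ennreal \<Rightarrow> (complex \<Rightarrow> complex) set" where
  "fock_space \<alpha> \<sigma> p q = {f. f holomorphic_on UNIV \<and> fock_norm \<alpha> \<sigma> p q f < \<infinity>}"


subsection \<open>Separated sets and localized families\<close>

text \<open>The separation constant; it is \<open>\<infinity>\<close> if \<open>\<Sigma>\<close> has at most one element.\<close>

definition separation :: "complex set \<Rightarrow> ennreal" where
  "separation \<Sigma> = (INF (\<xi>, \<eta>)\<in>{(\<xi>, \<eta>). \<xi> \<in> \<Sigma> \<and> \<eta> \<in> \<Sigma> \<and> \<xi> \<noteq> \<eta>}. ennreal (cmod (\<xi> - \<eta>)))"

definition separated_set :: "complex set \<Rightarrow> bool" where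
  "separated_set \<Sigma> \<longleftrightarrow> 0 < separation \<Sigma>"

definition localization_constants ::
    "real \<Rightarrow> complex set \<Rightarrow> (complex \<Rightarrow> complex \<Rightarrow> complex) \<Rightarrow> (real \<Rightarrow> real) \<Rightarrow> bool" where
  "localization_constants \<alpha> \<Sigma> \<phi> K \<longleftrightarrow>
     (\<forall>N>0. 0 < K N \<and>
       (\<forall>z. \<forall>\<xi>\<in>\<Sigma>. cmod (\<phi> \<xi> z) * exp (- (\<alpha> / 2) * (cmod z)\<^sup>2)
                    \<le> K N * (1 + cmod (z - \<xi>)) powr (- N)))"

definition rapidly_fock_localized ::
    "real \<Rightarrow> complex set \<Rightarrow> (complex \<Rightarrow> complex \<Rightarrow> complex) \<Rightarrow> bool" where
  "rapidly_fock_localized \<alpha> \<Sigma> \<phi> \<longleftrightarrow>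
     (\<forall>\<xi>\<in>\<Sigma>. \<phi> \<xi> holomorphic_on UNIV) \<and> (\<exists>K. localization_constants \<alpha> \<Sigma> \<phi> K)"


subsection \<open>Sequence spaces\<close>

definition lp_norm :: "ennreal \<Rightarrow> 'a set \<Rightarrow> ('a \<Rightarrow> ennreal) \<Rightarrow> ennreal" where
  "lp_norm p A x =
     (if p = \<infinity> then (SUP i\<in>A. x i)
      else epow (\<Sum>\<^sub>\<infinity>i\<in>A. epow (x i) (enn2real p)) (recip p))"

definition annulus_part :: "complex set \<Rightarrow> nat \<Rightarrow> complex set" where
  "annulus_part \<Sigma> m = \<Sigma> \<inter> {z. real m \<le> cmod z \<and> cmod z < real m + 1}"

definition block_norm :: "ennreal \<Rightarrow> real \<Rightarrow> complex set \<Rightarrow> (complex \<Rightarrow> complex) \<Rightarrow> nat \<Rightarrow> ennreal" where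
  "block_norm p \<nu> \<Sigma> c m =
     ennreal ((1 + real m) powr \<nu>) * lp_norm p (annulus_part \<Sigma> m) (\<lambda>\<xi>. ennreal (cmod (c \<xi>)))"

text \<open>
  A sequence indexed by \<open>\<Sigma>\<close> is represented by a function on all of \<open>\<complex>\<close>, of which only the
  values on \<open>\<Sigma>\<close> matter.
\<close>

definition ell_norm ::
    "ennreal \<Rightarrow> ennreal \<Rightarrow> real \<Rightarrow> complex set \<Rightarrow> (complex \<Rightarrow> complex) \<Rightarrow> ennreal" where
  "ell_norm p q \<nu> \<Sigma> c = lp_norm q UNIV (block_norm p \<nu> \<Sigma> c)"

definition ell_space ::
    "ennreal \<Rightarrow> ennreal \<Rightarrow> real \<Rightarrow> complex set \<Rightarrow> (complex \<Rightarrow> complex) set" where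
  "ell_space p q \<nu> \<Sigma> = {c. ell_norm p q \<nu> \<Sigma> c < \<infinity>}"

definition ell_space_0 ::
    "ennreal \<Rightarrow> real \<Rightarrow> complex set \<Rightarrow> (complex \<Rightarrow> complex) set" where
  "ell_space_0 p \<nu> \<Sigma> = {c \<in> ell_space p \<infinity> \<nu> \<Sigma>. block_norm p \<nu> \<Sigma> c \<longlonglongrightarrow> 0}"

definition ell_nat_norm ::
    "real \<Rightarrow> ennreal \<Rightarrow> ennreal \<Rightarrow> complex set \<Rightarrow> (complex \<Rightarrow> complex) \<Rightarrow> ennreal" where
  "ell_nat_norm \<sigma> p q = ell_norm p q (recip q - recip p + \<sigma>)"

definition ell_nat ::
    "real \<Rightarrow> ennreal \<Rightarrow> ennreal \<Rightarrow> complex set \<Rightarrow> (complex \<Rightarrow> complex) set" where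
  "ell_nat \<sigma> p q = ell_space p q (recip q - recip p + \<sigma>)"

definition ell_nat_0 :: "real \<Rightarrow> ennreal \<Rightarrow> complex set \<Rightarrow> (complex \<Rightarrow> complex) set" where
  "ell_nat_0 \<sigma> p = ell_space_0 p (- recip p + \<sigma>)"


subsection \<open>The synthesis operator\<close>

definition synthesis ::
    "complex set \<Rightarrow> (complex \<Rightarrow> complex \<Rightarrow> complex) \<Rightarrow> (complex \<Rightarrow> complex) \<Rightarrow> complex \<Rightarrow> complex" where
  "synthesis \<Sigma> \<phi> c = (\<lambda>z. \<Sum>\<^sub>\<infinity>\<xi>\<in>\<Sigma>. c \<xi> * \<phi> \<xi> z)"

text \<open>
  \<open>\<Sigma>\<close> carries no ordering, so locally uniform convergence of the series refers to the net of
  partial sums over the finite subsets of \<open>\<Sigma>\<close>; on \<open>\<complex>\<close> it amounts to uniform convergence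
  on compact sets.
\<close>

definition synthesis_converges ::
    "complex set \<Rightarrow> (complex \<Rightarrow> complex \<Rightarrow> complex) \<Rightarrow> (complex \<Rightarrow> complex) \<Rightarrow> bool" where
  "synthesis_converges \<Sigma> \<phi> c \<longleftrightarrow>
     (\<forall>z. (\<lambda>\<xi>. norm (c \<xi> * \<phi> \<xi> z)) summable_on \<Sigma>) \<and>
     (\<forall>B. compact B \<longrightarrow>
        uniform_limit B (\<lambda>F z. \<Sum>\<xi>\<in>F. c \<xi> * \<phi> \<xi> z) (synthesis \<Sigma> \<phi> c)
          (finite_subsets_at_top \<Sigma>))"

end

theory Submission
  imports Defs "HOL-Complex_Analysis.Complex_Analysis"
begin

text \<open>
  Rapid localization provides arbitrarily much polynomial decay away from each point of \<open>\<Sigma>\<close>. This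
  allows the wasteful estimate \<open>\<Sum> x u \<le> (sup x) (\<Sum> u)\<close>: part of the decay is used up to sum over
  \<open>\<Sigma>\<close>, and a supremum with the rest of the decay remains. A supremum is in turn at most the
  \<open>\<ell>\<^sup>p\<close> sum of the same terms, for every \<open>p > 0\<close>. Passing back and forth in this way costs finitely
  many powers of decay and replaces the inequalities of Hoelder, Jensen and Young, so that all
  exponents \<open>0 < p, q \<le> \<infinity>\<close>, below and above \<open>1\<close>, are treated alike.

  Let \<open>f\<close> be the sum of the series, let \<open>c\<close> be the coefficients, let \<open>a\<^sub>m\<close> be the \<open>\<ell>\<^sup>p\<close> norm of
  the coefficients over the annulus with index \<open>m\<close>, and let \<open>N\<close> and \<open>L\<close> be as large as desired.

  \<^item> As sums over \<open>\<Sigma>\<close> of \<open>(1 + \<bar>z - \<xi>\<bar>) powr (-4)\<close> are bounded uniformly in \<open>z\<close>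
    (\<open>separated_sum_bound\<close>), the weighted modulus of \<open>f\<close> at \<open>z\<close> is at most a constant times the
    supremum over \<open>\<xi>\<close> of \<open>\<bar>c \<xi>\<bar> (1 + \<bar>z - \<xi>\<bar>) powr (- N)\<close> (\<open>synthesis_pointwise_bound\<close>).

  \<^item> The average over the circle of radius \<open>r\<close> of \<open>(1 + \<bar>z - \<xi>\<bar>) powr (-2)\<close> is of order
    \<open>1 / (1 + r)\<close> (\<open>circle_integral_bound\<close>). Hence the weighted mean of order \<open>p\<close> at radius \<open>r\<close> is
    at most a constant times \<open>(1 + r) powr (- 1 / p)\<close> times the supremum over \<open>m\<close> of
    \<open>a\<^sub>m (1 + \<bar>r - m\<bar>) powr (- L)\<close> (\<open>circle_mean_block_bound\<close>).

  \<^item> Moving the power weights from \<open>r\<close> to \<open>m\<close> (\<open>peetre_inequality\<close>) turns \<open>a\<^sub>m\<close> into the weighted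
    block norm (\<open>synthesis_block_bound\<close>). Here the weight \<open>1 / q\<close> accounts for the factor \<open>r\<close> in
    the measure of the Fock norm, and integrating in \<open>r\<close> gives the asserted bound
    (\<open>fock_norm_le_ell_norm\<close>). The same estimate gives the decay for vanishing block norms when
    \<open>q = \<infinity>\<close> (\<open>SUP_shifted_decay_tendsto_0\<close>).

  The coefficients grow at most polynomially, so the series is dominated on compact sets by a
  summable family (\<open>synthesis_local_majorant\<close>). It therefore converges absolutely and locally
  uniformly, and its sum is entire.
\<close>

section \<open>Powers and sequence norms in the extended half-line\<close>

lemma epow_ennreal: "0 \<le> x \<Longrightarrow> epow (ennreal x) a = ennreal (x powr a)"
  by (simp add: epow_def)

lemma epow_mono:
  assumes "0 < a" "x \<le> y"
  shows "epow x a \<le> epow y a"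
proof (cases "y = \<infinity>")
  case False
  then have "x \<noteq> \<infinity>" and le: "enn2real x \<le> enn2real y"
    using assms by (auto simp: top_unique less_top intro!: enn2real_mono)
  show ?thesis
    using False \<open>x \<noteq> \<infinity>\<close> assms powr_mono2[OF _ _ le, of a]
    by (auto simp: epow_def intro!: ennreal_leI)
qed (simp add: epow_def)

lemma epow_mult:
  assumes "0 < a"
  shows "epow (x * y) a = epow x a * epow y a"
proof -
  have top: "epow (\<infinity> * y) a = epow \<infinity> a * epow y a" for y
    using assms by (cases y) (auto simp: epow_def ennreal_top_mult ennreal_mult_top)
  show ?thesis
  proof (cases "x = \<infinity> \<or> y = \<infinity>")
    case True
    then show ?thesis using top by (metis mult.commute)
  next
    case False
    then obtain u v where "x = ennreal u" "y = ennreal v" "0 \<le> u" "0 \<le> v"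
      by (cases x; cases y) auto
    then show ?thesis
      by (simp add: epow_ennreal powr_mult flip: ennreal_mult)
  qed
qed

lemma epow_inverse:
  assumes "0 < a"
  shows "epow (epow x a) (1 / a) = x" "epow (epow x (1 / a)) a = x"
  using assms by (cases x; simp add: epow_def powr_powr)+

lemma recip_finite: "p \<noteq> \<infinity> \<Longrightarrow> 0 < p \<Longrightarrow> recip p = 1 / enn2real p \<and> 0 < enn2real p"
  by (cases p) (auto simp: recip_def ennreal_less_zero_iff divide_ennreal
       simp flip: ennreal_1)

lemma recip_top [simp]: "recip top = 0"
  by (simp add: recip_def)

lemma sum_le_infsum_ennreal:
  fixes f :: "'a \<Rightarrow> ennreal"
  assumes "finite B" "B \<subseteq> A"
  shows "sum f B \<le> infsum f A"
proof -
  have "infsum f B \<le> infsum f A"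
    using assms by (intro infsum_mono_neutral nonneg_summable_on_complete) auto
  then show ?thesis using assms by simp
qed

text \<open>
  The sequence norms are unordered sums, whereas the interchange with an integral takes place for
  series over the naturals; this inequality is the passage between the two.
\<close>
lemma suminf_le_infsum_ennreal: "suminf f \<le> infsum f UNIV" for f :: "nat \<Rightarrow> ennreal"
  by (rule suminf_le_const) (auto intro: sum_le_infsum_ennreal)

lemma lp_norm_ge:
  assumes "0 < p" "i \<in> A"
  shows "x i \<le> lp_norm p A x"
proof (cases "p = \<infinity>")
  case True
  then show ?thesis using assms by (auto simp: lp_norm_def intro: SUP_upper)
next
  case False
  define a where "a = enn2real p"
  have a: "0 < a" "recip p = 1 / a" using recip_finite[OF False assms(1)] by (auto simp: a_def)
  have "x i = epow (epow (x i) a) (1 / a)" by (simp add: epow_inverse a)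
  also have "\<dots> \<le> epow (\<Sum>\<^sub>\<infinity>i\<in>A. epow (x i) a) (1 / a)"
    using sum_le_infsum_ennreal[of "{i}" A "\<lambda>i. epow (x i) a"] assms a
    by (intro epow_mono) auto
  finally show ?thesis using False by (simp add: lp_norm_def a_def[symmetric] a)
qed

section \<open>Sums over separated sets\<close>

lemma sum_int_bound:
  assumes "finite F"
  shows "(\<Sum>i\<in>F. 1 / (1 + \<bar>real_of_int i\<bar>)\<^sup>2) \<le> pi\<^sup>2 / 3"
proof -
  define g where "g n = 1 / (real n + 1)\<^sup>2" for n :: nat
  have *: "(\<Sum>i\<in>G. 1 / (1 + \<bar>real_of_int i\<bar>)\<^sup>2) \<le> pi\<^sup>2 / 6"
    if "finite G" "inj_on (\<lambda>i. nat \<bar>i\<bar>) G" for G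
  proof -
    have "(\<Sum>i\<in>G. 1 / (1 + \<bar>real_of_int i\<bar>)\<^sup>2) = (\<Sum>i\<in>G. g (nat \<bar>i\<bar>))"
      by (intro sum.cong) (auto simp: g_def add.commute)
    also have "\<dots> = sum g ((\<lambda>i. nat \<bar>i\<bar>) ` G)"
      using that by (simp add: sum.reindex)
    also have "\<dots> \<le> suminf g"
      using that inverse_squares_sums unfolding g_def
      by (intro sum_le_suminf) (auto simp: sums_iff add.commute)
    also have "\<dots> = pi\<^sup>2 / 6"
      using inverse_squares_sums unfolding g_def by (simp add: sums_iff add.commute)
    finally show ?thesis .
  qed
  have "F = {i\<in>F. 0 \<le> i} \<union> {i\<in>F. i < 0}" by auto
  then have "(\<Sum>i\<in>F. 1 / (1 + \<bar>real_of_int i\<bar>)\<^sup>2) =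
     (\<Sum>i\<in>{i\<in>F. 0 \<le> i}. 1 / (1 + \<bar>real_of_int i\<bar>)\<^sup>2) + (\<Sum>i\<in>{i\<in>F. i < 0}. 1 / (1 + \<bar>real_of_int i\<bar>)\<^sup>2)"
    using assms by (subst sum.union_disjoint[symmetric]) auto
  also have "\<dots> \<le> pi\<^sup>2 / 6 + pi\<^sup>2 / 6"
    using assms by (intro add_mono *) (auto simp: inj_on_def)
  finally show ?thesis by simp
qed

text \<open>
  A separated set meets each cell of a fine enough square grid at most once, so a sum over it of
  a decaying weight is dominated by a sum over the integer lattice. Placing the grid with a vertex
  at the centre \<open>z\<close> of the weight makes the resulting bound independent of \<open>z\<close>.
\<close>
lemma cell_index_bound:
  fixes u h :: real
  assumes "0 < h"
  shows "1 + \<bar>real_of_int \<lfloor>u / h\<rfloor>\<bar> \<le> (2 + 1 / h) * (1 + \<bar>u\<bar>)"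
proof -
  have "\<bar>real_of_int \<lfloor>u / h\<rfloor>\<bar> \<le> \<bar>u / h\<bar> + 1" by linarith
  then have "1 + \<bar>real_of_int \<lfloor>u / h\<rfloor>\<bar> \<le> 2 + 1 / h * \<bar>u\<bar>" using assms by (simp add: abs_div)
  also have "\<dots> \<le> (2 + 1 / h) * (1 + \<bar>u\<bar>)" using assms by (simp add: algebra_simps)
  finally show ?thesis .
qed

lemma same_cell_close:
  assumes "0 < h" "\<lfloor>u / h\<rfloor> = \<lfloor>v / h\<rfloor>"
  shows "\<bar>u - v\<bar> < (h :: real)"
proof -
  have "\<bar>u / h - v / h\<bar> < 1" using assms(2) by linarith
  then show ?thesis using assms(1) by (simp add: field_simps abs_div flip: diff_divide_distrib)
qed

text \<open>
  With exponent 4 the weight is at most the product of inverse squares of the two coordinates, and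
  the lattice sum factors into two convergent one-dimensional sums. The constant depends only on
  the separation \<open>\<delta>\<close>.
\<close>
lemma separated_sum_bound:
  fixes \<delta> :: real
  assumes \<delta>: "0 < \<delta>"
  obtains C where "0 < C"
    "\<And>F z. \<lbrakk>finite F; \<And>\<xi> \<eta>. \<xi> \<in> F \<Longrightarrow> \<eta> \<in> F \<Longrightarrow> \<xi> \<noteq> \<eta> \<Longrightarrow> \<delta> \<le> cmod (\<xi> - \<eta>)\<rbrakk>
       \<Longrightarrow> (\<Sum>\<xi>\<in>F. (1 + cmod (z - \<xi>)) powr (-4)) \<le> C"
proof
  \<comment> \<open>two points of one cell of side \<open>\<delta> / 2\<close> have distance less than \<open>\<delta>\<close>, since
     \<open>cmod\<close> is at most the sum of the absolute values of the two parts\<close>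
  define h where "h = \<delta> / 2"
  have h: "0 < h" using \<delta> by (simp add: h_def)
  define A where "A = (2 + 1 / h)"
  define C where "C = A ^ 4 * (pi\<^sup>2 / 3 * (pi\<^sup>2 / 3))"
  have A: "0 < A" using h by (simp add: A_def add_pos_pos)
  show "0 < C" using A by (auto simp: C_def)
  fix F z
  assume fin: "finite F"
    and sep: "\<And>\<xi> \<eta>. \<xi> \<in> F \<Longrightarrow> \<eta> \<in> F \<Longrightarrow> \<xi> \<noteq> \<eta> \<Longrightarrow> \<delta> \<le> cmod (\<xi> - \<eta>)"
  define k where "k \<xi> = (\<lfloor>Re (z - \<xi>) / h\<rfloor>, \<lfloor>Im (z - \<xi>) / h\<rfloor>)" for \<xi>
  define g where "g i = 1 / (1 + \<bar>real_of_int i\<bar>)\<^sup>2" for i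
  have inj: "inj_on k F"
  proof (rule inj_onI, rule ccontr)
    fix \<xi> \<eta> assume *: "\<xi> \<in> F" "\<eta> \<in> F" "k \<xi> = k \<eta>" "\<xi> \<noteq> \<eta>"
    have "\<bar>Re (z - \<xi>) - Re (z - \<eta>)\<bar> < h" "\<bar>Im (z - \<xi>) - Im (z - \<eta>)\<bar> < h"
      using *(3) unfolding k_def prod.inject by (blast intro: same_cell_close[OF h])+
    moreover have "cmod (\<xi> - \<eta>) \<le> \<bar>Re (\<xi> - \<eta>)\<bar> + \<bar>Im (\<xi> - \<eta>)\<bar>" by (rule cmod_le)
    ultimately have "cmod (\<xi> - \<eta>) < \<delta>" unfolding h_def minus_complex.sel by argo
    with sep[OF *(1,2,4)] show False by simp
  qed
  have weight: "(1 + cmod (z - \<xi>)) powr (-4) \<le> A ^ 4 * (g (fst (k \<xi>)) * g (snd (k \<xi>)))" for \<xi>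
  proof -
    define n where "n = cmod (z - \<xi>)"
    define i where "i = 1 + \<bar>real_of_int (fst (k \<xi>))\<bar>"
    define j where "j = 1 + \<bar>real_of_int (snd (k \<xi>))\<bar>"
    have n: "0 \<le> n" by (simp add: n_def)
    have "i \<le> A * (1 + \<bar>Re (z - \<xi>)\<bar>)" "j \<le> A * (1 + \<bar>Im (z - \<xi>)\<bar>)"
      unfolding i_def j_def k_def A_def fst_conv snd_conv by (rule cell_index_bound[OF h])+
    moreover have "A * (1 + \<bar>Re (z - \<xi>)\<bar>) \<le> A * (1 + n)" "A * (1 + \<bar>Im (z - \<xi>)\<bar>) \<le> A * (1 + n)"
      using A abs_Re_le_cmod[of "z - \<xi>"] abs_Im_le_cmod[of "z - \<xi>"] by (simp_all add: n_def)
    ultimately have "i \<le> A * (1 + n)" "j \<le> A * (1 + n)" by linarith+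
    moreover have ij: "1 \<le> i" "1 \<le> j" by (auto simp: i_def j_def)
    ultimately have "i\<^sup>2 * j\<^sup>2 \<le> (A * (1 + n))\<^sup>2 * (A * (1 + n))\<^sup>2"
      by (intro mult_mono power_mono) auto
    also have "\<dots> = A ^ 4 * (1 + n) ^ 4" by algebra
    finally have "i\<^sup>2 * j\<^sup>2 \<le> A ^ 4 * (1 + n) ^ 4" .
    then have "1 / (1 + n) ^ 4 \<le> A ^ 4 * (1 / i\<^sup>2 * (1 / j\<^sup>2))"
      using ij n by (simp add: field_simps)
    moreover have "(1 + n) powr (-4) = 1 / (1 + n) ^ 4"
      using n by (simp add: powr_minus powr_numeral divide_inverse)
    ultimately show ?thesis
      unfolding n_def[symmetric] g_def i_def[symmetric] j_def[symmetric] by simp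
  qed
  have "(\<Sum>\<xi>\<in>F. (1 + cmod (z - \<xi>)) powr (-4)) \<le> (\<Sum>\<xi>\<in>F. A ^ 4 * (g (fst (k \<xi>)) * g (snd (k \<xi>))))"
    by (intro sum_mono weight)
  also have "\<dots> = A ^ 4 * (\<Sum>x\<in>k ` F. g (fst x) * g (snd x))"
    using inj by (simp add: sum.reindex sum_distrib_left)
  also have "(\<Sum>x\<in>k ` F. g (fst x) * g (snd x))
      \<le> (\<Sum>x\<in>(fst ` k ` F) \<times> (snd ` k ` F). g (fst x) * g (snd x))"
    using fin by (intro sum_mono2 subset_fst_snd) (auto simp: g_def)
  also have "\<dots> = (\<Sum>i\<in>fst ` k ` F. g i) * (\<Sum>j\<in>snd ` k ` F. g j)"
    by (simp add: sum_product sum.cartesian_product case_prod_beta)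
  also have "\<dots> \<le> (pi\<^sup>2 / 3) * (pi\<^sup>2 / 3)"
    using fin unfolding g_def by (intro mult_mono sum_int_bound sum_nonneg) auto
  finally show "(\<Sum>\<xi>\<in>F. (1 + cmod (z - \<xi>)) powr (-4)) \<le> C"
    using A by (simp add: C_def)
qed

lemma le_separationD:
  assumes "ennreal \<delta> \<le> separation \<Sigma>" "\<xi> \<in> \<Sigma>" "\<eta> \<in> \<Sigma>" "\<xi> \<noteq> \<eta>"
  shows "\<delta> \<le> cmod (\<xi> - \<eta>)"
proof -
  have "separation \<Sigma> \<le> ennreal (cmod (\<xi> - \<eta>))"
    unfolding separation_def using assms(2-4) by (intro INF_lower2[where i = "(\<xi>, \<eta>)"]) auto
  then show ?thesis using assms(1) by (meson ennreal_le_iff norm_ge_zero order_trans)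
qed

section \<open>Circle means of the weights\<close>

lemma sin_ge_chord:
  assumes "\<bar>u\<bar> \<le> pi / 2"
  shows "2 / pi * \<bar>u\<bar> \<le> \<bar>sin u\<bar>"
proof -
  have conv: "convex_on {0..pi / 2} (\<lambda>x. - sin x)"
  proof (rule f''_ge0_imp_convex)
    fix x :: real assume x: "x \<in> {0..pi / 2}"
    show "((\<lambda>x. - sin x) has_real_derivative - cos x) (at x)"
      by (auto intro!: derivative_eq_intros)
    show "((\<lambda>x. - cos x) has_real_derivative sin x) (at x)"
      by (auto intro!: derivative_eq_intros)
    show "0 \<le> sin x" using x by (intro sin_ge_zero) auto
  qed simp
  have *: "2 / pi * v \<le> sin v" if "0 \<le> v" "v \<le> pi / 2" for v
  proof -
    have "- sin ((1 - 2 / pi * v) *\<^sub>R 0 + (2 / pi * v) *\<^sub>R (pi / 2))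
        \<le> (1 - 2 / pi * v) * - sin 0 + (2 / pi * v) * - sin (pi / 2)"
      using that by (intro convex_onD[OF conv]) (auto simp: field_simps)
    then show ?thesis by simp
  qed
  have "sin \<bar>u\<bar> \<le> \<bar>sin u\<bar>" by (cases "0 \<le> u") auto
  then show ?thesis using *[of "\<bar>u\<bar>"] assms by simp
qed

text \<open>
  This integral serves twice: for the angular integral of a weight, and for the radial integral in
  the Fock norm.
\<close>
lemma nn_integral_inverse_square:
  fixes a b :: real
  assumes b: "0 < b"
  shows "(\<integral>\<^sup>+x. ennreal ((1 + b * \<bar>x - a\<bar>) powr (-2)) \<partial>lborel) \<le> ennreal (2 / b)"
proof -
  define f where "f x = (1 + b * x) powr (-2)" for x :: real
  have [measurable]: "f \<in> borel_measurable borel" unfolding f_def by measurable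
  have half: "(\<integral>\<^sup>+x. ennreal (f x) * indicator {0..} x \<partial>lborel) = ennreal (1 / b)"
  proof -
    have "(\<integral>\<^sup>+x. ennreal (f x) * indicator {0..} x \<partial>lborel) = 0 - (- (1 / b) * inverse (1 + b * 0))"
    proof (rule nn_integral_FTC_atLeast[where F = "\<lambda>x. - (1 / b) * inverse (1 + b * x)"])
      fix x :: real assume "0 \<le> x"
      then have pos: "0 < 1 + b * x" using b by (simp add: add_pos_nonneg)
      then have "f x = inverse (1 + b * x) * inverse (1 + b * x)"
        by (simp add: f_def powr_minus powr_numeral power2_eq_square)
      then show "((\<lambda>x. - (1 / b) * inverse (1 + b * x)) has_real_derivative f x) (at x)"
        using b pos by (auto intro!: derivative_eq_intros simp: divide_inverse)
      show "0 \<le> f x" by (simp add: f_def)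
    next
      show "((\<lambda>x. - (1 / b) * inverse (1 + b * x)) \<longlongrightarrow> 0) at_top"
        using b by real_asymp
    qed auto
    then show ?thesis by simp
  qed
  have "(\<integral>\<^sup>+x. ennreal ((1 + b * \<bar>x - a\<bar>) powr (-2)) \<partial>lborel)
      \<le> (\<integral>\<^sup>+x. ennreal (f (x - a)) * indicator {0..} (x - a)
               + ennreal (f (a - x)) * indicator {0..} (a - x) \<partial>lborel)"
    by (intro nn_integral_mono) (auto simp: f_def indicator_def abs_if)
  also have "\<dots> = (\<integral>\<^sup>+x. ennreal (f (x - a)) * indicator {0..} (x - a) \<partial>lborel)
               + (\<integral>\<^sup>+x. ennreal (f (a - x)) * indicator {0..} (a - x) \<partial>lborel)"
    by (intro nn_integral_add) measurable
  also have "(\<integral>\<^sup>+x. ennreal (f (x - a)) * indicator {0..} (x - a) \<partial>lborel) = ennreal (1 / b)"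
    using nn_integral_real_affine[of "\<lambda>x. ennreal (f x) * indicator {0..} x" 1 "-a"] half by simp
  also have "(\<integral>\<^sup>+x. ennreal (f (a - x)) * indicator {0..} (a - x) \<partial>lborel) = ennreal (1 / b)"
    using nn_integral_real_affine[of "\<lambda>x. ennreal (f x) * indicator {0..} x" "-1" a] half by simp
  also have "ennreal (1 / b) + ennreal (1 / b) = ennreal (2 / b)"
    using b by (simp flip: ennreal_plus)
  finally show ?thesis .
qed

text \<open>
  The left-hand side is the distance from the point of the circle to the line through the origin
  and \<open>\<xi>\<close> (the real axis if \<open>\<xi> = 0\<close>).
\<close>
lemma circle_distance_ge:
  assumes "0 \<le> r"
  shows "r * \<bar>sin (\<theta> - Arg \<xi>)\<bar> \<le> cmod (rcis r \<theta> - \<xi>)"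
proof -
  have eq: "rcis r \<theta> - \<xi> = cis (Arg \<xi>) * (rcis r (\<theta> - Arg \<xi>) - of_real (cmod \<xi>))"
    using rcis_cmod_Arg[of \<xi>] by (simp add: rcis_def algebra_simps cis_mult)
  have "r * \<bar>sin (\<theta> - Arg \<xi>)\<bar> = \<bar>Im (rcis r (\<theta> - Arg \<xi>) - of_real (cmod \<xi>))\<bar>"
    using assms by (simp add: abs_mult)
  also have "\<dots> \<le> cmod (rcis r \<theta> - \<xi>)"
    unfolding eq norm_mult norm_cis mult_1_left by (rule abs_Im_le_cmod)
  finally show ?thesis .
qed

text \<open>
  The gain of the factor \<open>1 / (1 + r)\<close>: only an arc of length comparable to \<open>1\<close> of a circle of
  length \<open>2 \<pi> r\<close> lies near \<open>\<xi>\<close>. This factor produces the exponent \<open>- 1 / p\<close> in the natural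
  weight of the sequence space.
\<close>
lemma circle_integral_bound:
  assumes r: "0 \<le> r"
  shows "(\<integral>\<^sup>+\<theta>\<in>{0..2 * pi}. ennreal ((1 + cmod (rcis r \<theta> - \<xi>)) powr (-2)) \<partial>lborel)
      \<le> ennreal (10 * pi / (1 + r))"
    (is "?I \<le> _")
proof (cases "r \<le> 1")
  case True
  have "?I \<le> (\<integral>\<^sup>+\<theta>. indicator {0..2 * pi} \<theta> \<partial>lborel)"
    by (intro nn_integral_mono)
      (auto simp: indicator_def ennreal_le_1 powr_minus intro!: inverse_le_1_iff[THEN iffD2] ge_one_powr_ge_zero)
  also have "\<dots> = ennreal (2 * pi)" by simp
  also have "\<dots> \<le> ennreal (10 * pi / (1 + r))"
    using True r by (intro ennreal_leI) (simp add: field_simps)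
  finally show ?thesis .
next
  case False
  define b where "b = r * (2 / pi)"
  have b: "0 < b" using False by (simp add: b_def)
  define g where "g k \<theta> = ennreal ((1 + b * \<bar>\<theta> - (Arg \<xi> + of_int k * pi)\<bar>) powr (-2))" for k :: int and \<theta>
  have [measurable]: "g k \<in> borel_measurable borel" for k unfolding g_def by measurable
  \<comment> \<open>near each zero \<open>k \<pi>\<close> of the sine the weight is at most \<open>g k\<close>; as \<open>\<theta> - Arg \<xi>\<close> lies
     between \<open>- \<pi>\<close> and \<open>3 \<pi>\<close>, five zeros suffice\<close>
  have "ennreal ((1 + cmod (rcis r \<theta> - \<xi>)) powr (-2)) \<le> (\<Sum>k\<in>{-1..3}. g k \<theta>)"
    if \<theta>: "\<theta> \<in> {0..2 * pi}" for \<theta>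
  proof -
    define t where "t = \<theta> - Arg \<xi>"
    define k where "k = round (t / pi)"
    have t: "- pi \<le> t" "t < 3 * pi"
      using \<theta> Arg_bounded[of \<xi>] by (auto simp: t_def)
    then have t': "-1 \<le> t / pi" "t / pi < 3" by (simp_all add: field_simps)
    have k: "\<bar>t / pi - of_int k\<bar> \<le> 1 / 2"
      unfolding k_def using of_int_round_abs_le[of "t / pi"] by (simp add: abs_minus_commute)
    have "- 2 < real_of_int k" "real_of_int k < 4" using k t' by linarith+
    then have kr: "k \<in> {-1..3}" by auto
    have "\<bar>t - of_int k * pi\<bar> = pi * \<bar>t / pi - of_int k\<bar>"
    proof -
      have "t - of_int k * pi = pi * (t / pi - of_int k)" by (simp add: field_simps)
      then show ?thesis by (simp only: abs_mult) simp
    qed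
    also have "\<dots> \<le> pi / 2" using k by simp
    finally have "2 / pi * \<bar>t - of_int k * pi\<bar> \<le> \<bar>sin (t - of_int k * pi)\<bar>"
      by (rule sin_ge_chord)
    also have "\<dots> = \<bar>sin t\<bar>"
      by (simp add: sin_diff mult.commute[of "of_int k" pi] cos_npi_int)
    finally have "b * \<bar>t - of_int k * pi\<bar> \<le> r * \<bar>sin t\<bar>"
      unfolding b_def mult.assoc using r by (rule mult_left_mono)
    also have "\<dots> \<le> cmod (rcis r \<theta> - \<xi>)" unfolding t_def by (rule circle_distance_ge[OF r])
    finally have "(1 + cmod (rcis r \<theta> - \<xi>)) powr (-2) \<le> (1 + b * \<bar>t - of_int k * pi\<bar>) powr (-2)"
      using b by (intro powr_mono2') (auto intro!: add_pos_nonneg)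
    then have "ennreal ((1 + cmod (rcis r \<theta> - \<xi>)) powr (-2)) \<le> g k \<theta>"
      by (simp add: g_def t_def diff_diff_eq ennreal_leI)
    also have "\<dots> \<le> (\<Sum>k\<in>{-1..3}. g k \<theta>)" using kr by (intro member_le_sum) auto
    finally show ?thesis .
  qed
  then have "?I \<le> (\<integral>\<^sup>+\<theta>. (\<Sum>k\<in>{-1..3}. g k \<theta>) \<partial>lborel)"
    by (intro nn_integral_mono) (auto simp: indicator_def)
  also have "\<dots> = (\<Sum>k\<in>{-1..3}. \<integral>\<^sup>+\<theta>. g k \<theta> \<partial>lborel)" by (intro nn_integral_sum) measurable
  also have "\<dots> \<le> (\<Sum>k\<in>{-1..3::int}. ennreal (2 / b))"
    unfolding g_def by (intro sum_mono nn_integral_inverse_square b)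
  also have "\<dots> = ennreal (10 / b)" 
    using b by (simp add: ennreal_mult' flip: ennreal_numeral ennreal_mult)
  also have "\<dots> \<le> ennreal (10 * pi / (1 + r))"
    using False by (intro ennreal_leI) (simp add: b_def field_simps)
  finally show ?thesis .
qed

section \<open>Pointwise and circle mean estimates\<close>

lemma localization_constantsD:
  assumes "localization_constants \<alpha> \<Sigma> \<phi> K" "0 < N" "\<xi> \<in> \<Sigma>"
  shows "cmod (\<phi> \<xi> z) \<le> exp (\<alpha> / 2 * (cmod z)\<^sup>2) * K N * (1 + cmod (z - \<xi>)) powr (- N)"
proof -
  have le: "cmod (\<phi> \<xi> z) * exp (- (\<alpha> / 2) * (cmod z)\<^sup>2) \<le> K N * (1 + cmod (z - \<xi>)) powr (- N)"
    using assms unfolding localization_constants_def by blast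
  have "cmod (\<phi> \<xi> z) = exp (\<alpha> / 2 * (cmod z)\<^sup>2) * (cmod (\<phi> \<xi> z) * exp (- (\<alpha> / 2) * (cmod z)\<^sup>2))"
    by (simp flip: exp_add)
  also have "\<dots> \<le> exp (\<alpha> / 2 * (cmod z)\<^sup>2) * (K N * (1 + cmod (z - \<xi>)) powr (- N))"
    by (intro mult_left_mono le) simp
  finally show ?thesis
    by (simp only: mult.assoc)
qed

text \<open>
  Localization with the exponent \<open>N + 4\<close> is split: the factor with exponent 4 is summed over
  \<open>\<Sigma>\<close>, and the factor with exponent \<open>N\<close> stays with the coefficients, of which only the
  supremum is kept. At a point where the series is not summable the left-hand side is \<open>0\<close>,
  the default value of an infinite sum.
\<close>
lemma synthesis_pointwise_bound:
  assumes loc: "localization_constants \<alpha> \<Sigma> \<phi> K" and N: "0 \<le> N"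
    and C: "\<And>F z. finite F \<Longrightarrow> F \<subseteq> \<Sigma> \<Longrightarrow> (\<Sum>\<xi>\<in>F. (1 + cmod (z - \<xi>)) powr (-4)) \<le> C"
  shows "ennreal (cmod (synthesis \<Sigma> \<phi> c z)) \<le> ennreal (exp (\<alpha> / 2 * (cmod z)\<^sup>2) * K (N + 4) * C) *
      (SUP \<xi>\<in>\<Sigma>. ennreal (cmod (c \<xi>) * (1 + cmod (z - \<xi>)) powr (- N)))"
proof -
  define S where "S = (SUP \<xi>\<in>\<Sigma>. ennreal (cmod (c \<xi>) * (1 + cmod (z - \<xi>)) powr (- N)))"
  define E where "E = exp (\<alpha> / 2 * (cmod z)\<^sup>2) * K (N + 4)"
  have K: "0 < K (N + 4)" using loc N unfolding localization_constants_def by auto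
  have E: "0 < E" using K by (simp add: E_def)
  have C0: "0 \<le> C" using C[of "{}" 0] by simp
  have fin: "ennreal (\<Sum>\<xi>\<in>F. norm (c \<xi> * \<phi> \<xi> z)) \<le> ennreal (E * C) * S"
    if F: "finite F" "F \<subseteq> \<Sigma>" for F
  proof -
    have "ennreal (\<Sum>\<xi>\<in>F. norm (c \<xi> * \<phi> \<xi> z)) = (\<Sum>\<xi>\<in>F. ennreal (norm (c \<xi> * \<phi> \<xi> z)))"
      by (simp add: sum_ennreal)
    also have "\<dots> \<le> (\<Sum>\<xi>\<in>F. ennreal (E * (1 + cmod (z - \<xi>)) powr (-4)) * S)"
    proof (rule sum_mono)
      fix \<xi> assume "\<xi> \<in> F"
      then have \<xi>: "\<xi> \<in> \<Sigma>" using F by auto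
      have "norm (c \<xi> * \<phi> \<xi> z) \<le> cmod (c \<xi>) * (E * (1 + cmod (z - \<xi>)) powr (- (N + 4)))"
        unfolding norm_mult E_def
        by (intro mult_left_mono localization_constantsD[OF loc _ \<xi>]) (use N in auto)
      also have "\<dots> = (E * (1 + cmod (z - \<xi>)) powr (-4)) * (cmod (c \<xi>) * (1 + cmod (z - \<xi>)) powr (- N))"
        by (simp add: algebra_simps flip: powr_add)
      finally have "ennreal (norm (c \<xi> * \<phi> \<xi> z))
          \<le> ennreal (E * (1 + cmod (z - \<xi>)) powr (-4)) * ennreal (cmod (c \<xi>) * (1 + cmod (z - \<xi>)) powr (- N))"
        using E by (subst ennreal_mult[symmetric]) (auto intro: ennreal_leI)
      also have "\<dots> \<le> ennreal (E * (1 + cmod (z - \<xi>)) powr (-4)) * S"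
        unfolding S_def using \<xi> by (intro mult_left_mono SUP_upper) auto
      finally show "ennreal (norm (c \<xi> * \<phi> \<xi> z)) \<le> ennreal (E * (1 + cmod (z - \<xi>)) powr (-4)) * S" .
    qed
    also have "\<dots> = ennreal (E * (\<Sum>\<xi>\<in>F. (1 + cmod (z - \<xi>)) powr (-4))) * S"
      using E by (simp add: sum_ennreal sum_distrib_left flip: sum_distrib_right)
    also have "\<dots> \<le> ennreal (E * C) * S"
      using E C[OF F] by (intro mult_right_mono ennreal_leI) auto
    finally show ?thesis .
  qed
  have "ennreal (cmod (synthesis \<Sigma> \<phi> c z)) \<le> ennreal (E * C) * S"
  proof (cases "(\<lambda>\<xi>. norm (c \<xi> * \<phi> \<xi> z)) summable_on \<Sigma>")
    case True
    then have "cmod (synthesis \<Sigma> \<phi> c z) \<le> (\<Sum>\<^sub>\<infinity>\<xi>\<in>\<Sigma>. norm (c \<xi> * \<phi> \<xi> z))"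
      unfolding synthesis_def by (rule norm_infsum_bound)
    then have "ennreal (cmod (synthesis \<Sigma> \<phi> c z)) \<le> ennreal (\<Sum>\<^sub>\<infinity>\<xi>\<in>\<Sigma>. norm (c \<xi> * \<phi> \<xi> z))"
      by (rule ennreal_leI)
    also have "\<dots> \<le> ennreal (E * C) * S"
      using True by (subst infsum_nonneg_is_SUPREMUM_ennreal) (auto intro!: SUP_least fin)
    finally show ?thesis .
  next
    case False
    then have "synthesis \<Sigma> \<phi> c z = 0"
      by (auto simp: synthesis_def infsum_def summable_on_iff_abs_summable_on_complex)
    then show ?thesis by simp
  qed
  then show ?thesis by (simp add: E_def S_def)
qed

lemma annulus_part_cover:
  assumes "\<xi> \<in> \<Sigma>"
  obtains m where "\<xi> \<in> annulus_part \<Sigma> m"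
proof
  show "\<xi> \<in> annulus_part \<Sigma> (nat \<lfloor>cmod \<xi>\<rfloor>)"
    using assms by (auto simp: annulus_part_def of_nat_nat)
qed

text \<open>
  The distance of \<open>z\<close> and \<open>\<xi>\<close> is at least the difference of their moduli, in which \<open>m\<close> replaces
  the modulus of \<open>\<xi>\<close> with an error of at most 1; this error costs the factor \<open>2 powr L\<close>.
\<close>
lemma annulus_weight_le:
  assumes "\<xi> \<in> annulus_part \<Sigma> m" "cmod z = r" "0 \<le> L"
  shows "(1 + cmod (z - \<xi>)) powr (- L) \<le> 2 powr L * (1 + \<bar>r - real m\<bar>) powr (- L)"
proof -
  have "\<bar>r - cmod \<xi>\<bar> \<le> cmod (z - \<xi>)"
    using norm_triangle_ineq3[of z \<xi>] assms by simp
  moreover have "real m \<le> cmod \<xi>" "cmod \<xi> < real m + 1"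
    using assms by (auto simp: annulus_part_def)
  ultimately have le: "(1 + \<bar>r - real m\<bar>) / 2 \<le> 1 + cmod (z - \<xi>)" by argo
  have "(1 + cmod (z - \<xi>)) powr (- L) \<le> ((1 + \<bar>r - real m\<bar>) / 2) powr (- L)"
    using assms le by (intro powr_mono2') auto
  also have "\<dots> = 2 powr L * (1 + \<bar>r - real m\<bar>) powr (- L)"
    by (simp add: powr_divide powr_minus field_simps)
  finally show ?thesis .
qed

lemma nat_sum_bound:
  obtains T where "0 < T" "\<And>r :: real. (\<Sum>m. ennreal ((1 + \<bar>r - real m\<bar>) powr (-4))) \<le> ennreal T"
proof -
  obtain T where T: "0 < T" "\<And>F z. \<lbrakk>finite F; \<And>\<xi> \<eta>. \<xi> \<in> F \<Longrightarrow> \<eta> \<in> F \<Longrightarrow> \<xi> \<noteq> \<eta> \<Longrightarrow> 1 \<le> cmod (\<xi> - \<eta>)\<rbrakk>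
       \<Longrightarrow> (\<Sum>\<xi>\<in>F. (1 + cmod (z - \<xi>)) powr (-4)) \<le> T"
    using separated_sum_bound[of 1] by auto
  \<comment> \<open>the natural numbers, as points of the plane, have separation 1\<close>
  have "(\<Sum>m. ennreal ((1 + \<bar>r - real m\<bar>) powr (-4))) \<le> ennreal T" for r
  proof (rule suminf_le_const)
    fix n
    have dist: "cmod (of_real r - of_nat m) = \<bar>r - real m\<bar>" for m
      by (metis norm_of_real of_real_diff of_real_of_nat_eq)
    have "1 \<le> cmod (of_nat i - of_nat j)" if "i \<noteq> j" for i j :: nat
    proof -
      have "cmod (of_nat i - of_nat j) = \<bar>real i - real j\<bar>"
        by (metis norm_of_real of_real_diff of_real_of_nat_eq)
      then show ?thesis using that by linarith
    qed
    then have "(\<Sum>\<xi>\<in>of_nat ` {..<n}. (1 + cmod (of_real r - \<xi>)) powr (-4)) \<le> T"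
      by (intro T(2)) auto
    then have "(\<Sum>m<n. (1 + \<bar>r - real m\<bar>) powr (-4)) \<le> T"
      by (subst (asm) sum.reindex) (auto simp: inj_on_def dist)
    then show "(\<Sum>m<n. ennreal ((1 + \<bar>r - real m\<bar>) powr (-4))) \<le> ennreal T"
      by (simp add: sum_ennreal ennreal_leI)
  qed simp
  with T(1) show thesis by (rule that)
qed

text \<open>
  The \<open>p\<close>-th power of a supremum is at most the sum of the \<open>p\<close>-th powers, and such a sum can be
  integrated over the circle term by term. The total decay \<open>N p = L p + 6\<close> is spent as follows:
  2 on the angular integral, 4 on the summation over the annuli, and \<open>L p\<close> is kept, so that in the
  end again only a supremum over the annuli remains.
\<close>
lemma circle_mean_finite_block_bound:
  fixes p :: ennreal and a L N r E :: real
  assumes p: "p \<noteq> \<infinity>" "0 < p" and a: "a = enn2real p" and L: "0 \<le> L" and N: "N * a = L * a + 6"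
    and T: "0 \<le> T" "\<And>r :: real. (\<Sum>m. ennreal ((1 + \<bar>r - real m\<bar>) powr (-4))) \<le> ennreal T"
    and fin: "\<And>m. finite (annulus_part \<Sigma> m)" and E: "0 \<le> E" and r: "0 \<le> r"
    and le: "\<And>\<theta>. ennreal (cmod (f (rcis r \<theta>))) \<le> ennreal E *
        (SUP \<xi>\<in>\<Sigma>. ennreal (cmod (c \<xi>) * (1 + cmod (rcis r \<theta> - \<xi>)) powr (- N)))"
  shows "circle_mean p f r \<le> ennreal ((2 powr (L * a + 4) * 5 * T) powr (1 / a) * E * (1 + r) powr (- (1 / a))) *
      (SUP m. lp_norm p (annulus_part \<Sigma> m) (\<lambda>\<xi>. ennreal (cmod (c \<xi>))) * ennreal ((1 + \<bar>r - real m\<bar>) powr (- L)))"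
proof -
  have a0: "0 < a" and rec: "recip p = 1 / a" using recip_finite[OF p] a by auto
  define A where "A m = lp_norm p (annulus_part \<Sigma> m) (\<lambda>\<xi>. ennreal (cmod (c \<xi>)))" for m
  define D where "D = (SUP m. A m * ennreal ((1 + \<bar>r - real m\<bar>) powr (- L)))"
  define w where "w m = (1 + \<bar>r - real m\<bar>) powr (- (L * a + 4))" for m
  define B where "B = 2 powr (L * a + 4)"
  define k where "k \<xi> \<theta> = ennreal ((1 + cmod (rcis r \<theta> - \<xi>)) powr (-2))" for \<xi> \<theta>
  define b where "b m \<xi> = ennreal (B * w m * cmod (c \<xi>) powr a)" for m \<xi>
  have [measurable]: "k \<xi> \<in> borel_measurable borel" for \<xi>
  proof -
    have "continuous_on UNIV (\<lambda>\<theta>. cmod (rcis r \<theta> - \<xi>))"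
      unfolding rcis_def cis_conv_exp by (intro continuous_intros)
    then have [measurable]: "(\<lambda>\<theta>. cmod (rcis r \<theta> - \<xi>)) \<in> borel_measurable borel"
      by (rule borel_measurable_continuous_onI)
    show ?thesis unfolding k_def by measurable
  qed
  have Apow: "epow (A m) a = (\<Sum>\<xi>\<in>annulus_part \<Sigma> m. ennreal (cmod (c \<xi>) powr a))" for m
    using p fin a0 by (simp add: A_def lp_norm_def a[symmetric] rec epow_inverse epow_ennreal)
  have pointwise: "epow (ennreal (cmod (f (rcis r \<theta>)))) a
      \<le> ennreal (E powr a) * (\<Sum>m. \<Sum>\<xi>\<in>annulus_part \<Sigma> m. b m \<xi> * k \<xi> \<theta>)" (is "_ \<le> _ * ?W") for \<theta>
  proof -
    define x where "x \<xi> = cmod (c \<xi>) * (1 + cmod (rcis r \<theta> - \<xi>)) powr (- N)" for \<xi>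
    have "(SUP \<xi>\<in>\<Sigma>. ennreal (x \<xi>)) \<le> epow ?W (1 / a)"
    proof (rule SUP_least)
      fix \<xi> assume "\<xi> \<in> \<Sigma>"
      then obtain m where m: "\<xi> \<in> annulus_part \<Sigma> m" by (rule annulus_part_cover)
      have x0: "0 \<le> x \<xi>" by (simp add: x_def)
      have "x \<xi> powr a = cmod (c \<xi>) powr a * (1 + cmod (rcis r \<theta> - \<xi>)) powr (- N * a)"
        by (simp add: x_def powr_mult powr_powr)
      also have "- N * a = -2 + - (L * a + 4)" using N by simp
      also have "cmod (c \<xi>) powr a * (1 + cmod (rcis r \<theta> - \<xi>)) powr (-2 + - (L * a + 4)) =
          cmod (c \<xi>) powr a * (1 + cmod (rcis r \<theta> - \<xi>)) powr (-2) * (1 + cmod (rcis r \<theta> - \<xi>)) powr (- (L * a + 4))"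
        unfolding powr_add by simp
      also have "\<dots> \<le> cmod (c \<xi>) powr a * (1 + cmod (rcis r \<theta> - \<xi>)) powr (-2) * (B * w m)"
        unfolding B_def w_def
        using L a0 r by (intro mult_left_mono annulus_weight_le[OF m]) auto
      finally have "ennreal (x \<xi> powr a) \<le> b m \<xi> * k \<xi> \<theta>"
        unfolding b_def k_def
        by (subst ennreal_mult[symmetric]) (auto simp: B_def w_def mult_ac intro!: ennreal_leI)
      also have "\<dots> \<le> (\<Sum>\<xi>\<in>annulus_part \<Sigma> m. b m \<xi> * k \<xi> \<theta>)"
        using m fin by (intro member_le_sum) auto
      also have "\<dots> \<le> ?W"
        using sum_le_suminf[of "\<lambda>m. \<Sum>\<xi>\<in>annulus_part \<Sigma> m. b m \<xi> * k \<xi> \<theta>" "{m}"] by simp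
      finally have "epow (ennreal (x \<xi> powr a)) (1 / a) \<le> epow ?W (1 / a)"
        using a0 by (intro epow_mono) auto
      then show "ennreal (x \<xi>) \<le> epow ?W (1 / a)"
        using a0 x0 by (simp add: epow_ennreal powr_powr)
    qed
    then have "ennreal (cmod (f (rcis r \<theta>))) \<le> ennreal E * epow ?W (1 / a)"
      using le[of \<theta>] unfolding x_def by (meson mult_left_mono order_trans zero_le)
    then have "epow (ennreal (cmod (f (rcis r \<theta>)))) a \<le> epow (ennreal E * epow ?W (1 / a)) a"
      using a0 by (intro epow_mono) auto
    also have "\<dots> = ennreal (E powr a) * ?W"
      using a0 E by (simp add: epow_mult epow_inverse epow_ennreal)
    finally show ?thesis .
  qed
  \<comment> \<open>the remaining decay turns the block norms into \<open>D\<close> and leaves a summable factor\<close>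
  have block: "(\<Sum>\<xi>\<in>annulus_part \<Sigma> m. b m \<xi> * ennreal (10 * pi / (1 + r)))
      \<le> ennreal (B * 10 * pi / (1 + r)) * epow D a * ennreal ((1 + \<bar>r - real m\<bar>) powr (-4))" for m
  proof -
    have "(\<Sum>\<xi>\<in>annulus_part \<Sigma> m. b m \<xi> * ennreal (10 * pi / (1 + r)))
        = (\<Sum>\<xi>\<in>annulus_part \<Sigma> m. ennreal (B * 10 * pi / (1 + r)) * ennreal (w m) * ennreal (cmod (c \<xi>) powr a))"
      using r by (intro sum.cong refl) (simp add: b_def B_def w_def mult_ac flip: ennreal_mult)
    also have "\<dots> = ennreal (B * 10 * pi / (1 + r)) * ennreal (w m) * epow (A m) a"
      unfolding Apow by (rule sum_distrib_left[symmetric])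
    also have "ennreal (w m) = ennreal ((1 + \<bar>r - real m\<bar>) powr (-4)) * epow (ennreal ((1 + \<bar>r - real m\<bar>) powr (- L))) a"
      by (simp add: epow_ennreal w_def powr_powr algebra_simps flip: ennreal_mult powr_add)
    also have "ennreal (B * 10 * pi / (1 + r)) *
          (ennreal ((1 + \<bar>r - real m\<bar>) powr (-4)) * epow (ennreal ((1 + \<bar>r - real m\<bar>) powr (- L))) a) * epow (A m) a
        = ennreal (B * 10 * pi / (1 + r)) * epow (A m * ennreal ((1 + \<bar>r - real m\<bar>) powr (- L))) a
          * ennreal ((1 + \<bar>r - real m\<bar>) powr (-4))"
      by (simp add: epow_mult[OF a0] mult_ac)
    also have "\<dots> \<le> ennreal (B * 10 * pi / (1 + r)) * epow D a * ennreal ((1 + \<bar>r - real m\<bar>) powr (-4))"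
      unfolding D_def using a0 by (intro mult_left_mono mult_right_mono epow_mono SUP_upper) auto
    finally show ?thesis .
  qed
  have "(\<integral>\<^sup>+\<theta>\<in>{0..2 * pi}. epow (ennreal (cmod (f (rcis r \<theta>)))) a \<partial>lborel)
      \<le> (\<integral>\<^sup>+\<theta>. ennreal (E powr a) * (\<Sum>m. \<Sum>\<xi>\<in>annulus_part \<Sigma> m. b m \<xi> * (k \<xi> \<theta> * indicator {0..2 * pi} \<theta>)) \<partial>lborel)"
    using pointwise by (intro nn_integral_mono) (auto simp: indicator_def)
  also have "\<dots> = ennreal (E powr a) *
      (\<Sum>m. \<Sum>\<xi>\<in>annulus_part \<Sigma> m. b m \<xi> * (\<integral>\<^sup>+\<theta>\<in>{0..2 * pi}. k \<xi> \<theta> \<partial>lborel))"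
    by (simp add: nn_integral_cmult nn_integral_suminf nn_integral_sum)
  also have "\<dots> \<le> ennreal (E powr a) *
      (\<Sum>m. \<Sum>\<xi>\<in>annulus_part \<Sigma> m. b m \<xi> * ennreal (10 * pi / (1 + r)))"
    unfolding k_def
    by (intro mult_left_mono suminf_le sum_mono circle_integral_bound[OF r]) auto
  also have "\<dots> \<le> ennreal (E powr a) *
      (\<Sum>m. ennreal (B * 10 * pi / (1 + r)) * epow D a * ennreal ((1 + \<bar>r - real m\<bar>) powr (-4)))"
    by (intro mult_left_mono suminf_le block) auto
  also have "\<dots> \<le> ennreal (E powr a) * (ennreal (B * 10 * pi / (1 + r)) * epow D a * ennreal T)"
    unfolding ennreal_suminf_cmult by (intro mult_left_mono T(2)) auto
  finally have "ennreal (1 / (2 * pi)) * (\<integral>\<^sup>+\<theta>\<in>{0..2 * pi}. epow (ennreal (cmod (f (rcis r \<theta>)))) a \<partial>lborel)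
      \<le> ennreal (1 / (2 * pi)) * (ennreal (E powr a) * (ennreal (B * 10 * pi / (1 + r)) * epow D a * ennreal T))"
    by (rule mult_left_mono) simp
  also have "\<dots> = ennreal (1 / (2 * pi)) * ennreal (E powr a) * ennreal (B * 10 * pi / (1 + r)) * ennreal T * epow D a"
    by (simp only: mult_ac)
  also have "\<dots> = ennreal (B * 5 * T * E powr a * (1 / (1 + r))) * epow D a"
    using T(1) r by (simp add: B_def mult_ac flip: ennreal_mult)
  finally have "circle_mean p f r \<le> epow (ennreal (B * 5 * T * E powr a * (1 / (1 + r))) * epow D a) (1 / a)"
    unfolding circle_mean_def rec a[symmetric] using p a0 by (auto intro!: epow_mono)
  also have "\<dots> = ennreal ((B * 5 * T) powr (1 / a) * E * (1 + r) powr (- (1 / a))) * D"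
  proof -
    have "(1 / (1 + r)) powr (1 / a) = (1 + r) powr (- (1 / a))"
      using r by (simp add: powr_divide powr_minus_divide)
    then have "(B * 5 * T * E powr a * (1 / (1 + r))) powr (1 / a)
        = (B * 5 * T) powr (1 / a) * E * (1 + r) powr (- (1 / a))"
      using a0 T(1) E r by (simp only: powr_mult powr_powr) (simp add: B_def)
    moreover have "0 \<le> B * 5 * T * E powr a * (1 / (1 + r))"
      using T(1) r by (simp add: B_def)
    ultimately show ?thesis using a0 by (simp only: epow_mult epow_inverse epow_ennreal zero_less_divide_1_iff)
  qed
  finally show ?thesis by (simp add: B_def D_def A_def)
qed

lemma circle_mean_infinite_block_bound:
  fixes L r E :: real
  assumes L: "0 \<le> L" and E: "0 \<le> E" and r: "0 \<le> r"
    and le: "\<And>\<theta>. ennreal (cmod (f (rcis r \<theta>))) \<le> ennreal E *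
        (SUP \<xi>\<in>\<Sigma>. ennreal (cmod (c \<xi>) * (1 + cmod (rcis r \<theta> - \<xi>)) powr (- L)))"
  shows "circle_mean \<infinity> f r \<le> ennreal (2 powr L * E) *
      (SUP m. lp_norm \<infinity> (annulus_part \<Sigma> m) (\<lambda>\<xi>. ennreal (cmod (c \<xi>))) * ennreal ((1 + \<bar>r - real m\<bar>) powr (- L)))"
proof -
  define A where "A m = lp_norm \<infinity> (annulus_part \<Sigma> m) (\<lambda>\<xi>. ennreal (cmod (c \<xi>)))" for m
  define D where "D = (SUP m. A m * ennreal ((1 + \<bar>r - real m\<bar>) powr (- L)))"
  have "ennreal (cmod (f (rcis r \<theta>))) \<le> ennreal (2 powr L * E) * D" for \<theta>
  proof -
    have "(SUP \<xi>\<in>\<Sigma>. ennreal (cmod (c \<xi>) * (1 + cmod (rcis r \<theta> - \<xi>)) powr (- L))) \<le> ennreal (2 powr L) * D"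
    proof (rule SUP_least)
      fix \<xi> assume "\<xi> \<in> \<Sigma>"
      then obtain m where m: "\<xi> \<in> annulus_part \<Sigma> m" by (rule annulus_part_cover)
      have "cmod (c \<xi>) * (1 + cmod (rcis r \<theta> - \<xi>)) powr (- L)
          \<le> cmod (c \<xi>) * (2 powr L * (1 + \<bar>r - real m\<bar>) powr (- L))"
        using L r by (intro mult_left_mono annulus_weight_le[OF m]) auto
      then have "ennreal (cmod (c \<xi>) * (1 + cmod (rcis r \<theta> - \<xi>)) powr (- L))
          \<le> ennreal (2 powr L) * (ennreal (cmod (c \<xi>)) * ennreal ((1 + \<bar>r - real m\<bar>) powr (- L)))"
        by (subst ennreal_mult[symmetric], simp, simp)+ (auto simp: mult_ac intro!: ennreal_leI)
      also have "\<dots> \<le> ennreal (2 powr L) * (A m * ennreal ((1 + \<bar>r - real m\<bar>) powr (- L)))"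
        unfolding A_def using m
        by (intro mult_left_mono mult_right_mono lp_norm_ge[where x = "\<lambda>\<xi>. ennreal (cmod (c \<xi>))"]) auto
      also have "\<dots> \<le> ennreal (2 powr L) * D"
        unfolding D_def by (intro mult_left_mono SUP_upper) auto
      finally show "ennreal (cmod (c \<xi>) * (1 + cmod (rcis r \<theta> - \<xi>)) powr (- L)) \<le> ennreal (2 powr L) * D" .
    qed
    then have "ennreal (cmod (f (rcis r \<theta>))) \<le> ennreal E * (ennreal (2 powr L) * D)"
      using le[of \<theta>] by (meson mult_left_mono order_trans zero_le)
    then show ?thesis using E by (simp add: ennreal_mult mult_ac)
  qed
  then show ?thesis unfolding circle_mean_def D_def A_def by (auto intro: SUP_least)
qed

text \<open>
  Both cases in one form; \<open>B\<close> and \<open>N\<close> depend on \<open>p\<close> and \<open>L\<close> alone.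
\<close>
lemma circle_mean_block_bound:
  fixes p :: ennreal and L :: real
  assumes p: "0 < p" and L: "0 \<le> L"
  obtains B N where "0 < B" "0 \<le> N"
    "\<And>\<Sigma> c f E r. \<lbrakk>\<And>m. finite (annulus_part \<Sigma> m); 0 \<le> E; 0 \<le> r;
       \<And>\<theta>. ennreal (cmod (f (rcis r \<theta>))) \<le> ennreal E *
        (SUP \<xi>\<in>\<Sigma>. ennreal (cmod (c \<xi>) * (1 + cmod (rcis r \<theta> - \<xi>)) powr (- N)))\<rbrakk> \<Longrightarrow>
     circle_mean p f r \<le> ennreal (B * E * (1 + r) powr (- recip p)) *
      (SUP m. lp_norm p (annulus_part \<Sigma> m) (\<lambda>\<xi>. ennreal (cmod (c \<xi>))) * ennreal ((1 + \<bar>r - real m\<bar>) powr (- L)))"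
proof (cases "p = \<infinity>")
  case True
  show thesis
    by (rule that[of "2 powr L" L])
      (use L circle_mean_infinite_block_bound[OF L] in \<open>simp_all add: True\<close>)
next
  case False
  obtain T where T: "0 < T" "\<And>r :: real. (\<Sum>m. ennreal ((1 + \<bar>r - real m\<bar>) powr (-4))) \<le> ennreal T"
    by (rule nat_sum_bound) blast
  define a where "a = enn2real p"
  have a: "0 < a" "recip p = 1 / a" using recip_finite[OF False p] by (auto simp: a_def)
  define N where "N = L + 6 / a"
  have N: "N * a = L * a + 6" "0 \<le> N" using a L by (simp_all add: N_def field_simps)
  show thesis
  proof (rule that)
    show "0 < (2 powr (L * a + 4) * 5 * T) powr (1 / a)" using T(1) by simp
    show "0 \<le> N" by (rule N)
  qed (unfold a(2), rule circle_mean_finite_block_bound[OF False p a_def L N(1) less_imp_le[OF T(1)] T(2)])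
qed

section \<open>Weighted estimates between radii and annuli\<close>

text \<open>
  On a bounded set the weight centred at the origin is bounded below, so the uniform bound on its
  sums bounds the number of points.
\<close>
lemma finite_annulus_part:
  assumes \<delta>: "0 < \<delta>" "ennreal \<delta> \<le> separation \<Sigma>"
  shows "finite (annulus_part \<Sigma> m)"
proof -
  obtain C where C: "0 < C" "\<And>F z. \<lbrakk>finite F; \<And>\<xi> \<eta>. \<xi> \<in> F \<Longrightarrow> \<eta> \<in> F \<Longrightarrow> \<xi> \<noteq> \<eta> \<Longrightarrow> \<delta> \<le> cmod (\<xi> - \<eta>)\<rbrakk>
       \<Longrightarrow> (\<Sum>\<xi>\<in>F. (1 + cmod (z - \<xi>)) powr (-4)) \<le> C"
    by (rule separated_sum_bound[OF \<delta>(1)]) blast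
  define k where "k = (2 + real m) powr (-4)"
  have k: "0 < k" by (simp add: k_def)
  have "card F \<le> nat \<lfloor>C / k\<rfloor>" if F: "F \<subseteq> annulus_part \<Sigma> m" "finite F" for F
  proof -
    have "real (card F) * k = (\<Sum>\<xi>\<in>F. k)" by simp
    also have "\<dots> \<le> (\<Sum>\<xi>\<in>F. (1 + cmod (0 - \<xi>)) powr (-4))"
      unfolding k_def using F
      by (intro sum_mono powr_mono2') (auto simp: annulus_part_def add_pos_nonneg)
    also have "\<dots> \<le> C"
      using F le_separationD[OF \<delta>(2)] by (intro C(2)) (auto simp: annulus_part_def)
    finally have "real (card F) \<le> C / k" using k by (simp add: field_simps)
    then show ?thesis by (simp add: le_nat_floor)
  qed
  then show ?thesis by (intro finite_if_finite_subsets_card_bdd[THEN conjunct1]) auto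
qed

text \<open>
  This lets a power weight be moved from the radius \<open>r\<close> to the annulus index \<open>m\<close>, at the cost
  of some of the decay in \<open>r - m\<close>.
\<close>
lemma peetre_inequality:
  fixes r m t :: real
  assumes "0 \<le> r" "0 \<le> m"
  shows "(1 + r) powr t \<le> (1 + m) powr t * (1 + \<bar>r - m\<bar>) powr \<bar>t\<bar>"
proof -
  have *: "1 + x \<le> (1 + y) * (1 + \<bar>x - y\<bar>)" if "0 \<le> x" "0 \<le> y" for x y :: real
  proof -
    have "0 \<le> y * \<bar>x - y\<bar>" using that by simp
    then show ?thesis by (simp add: algebra_simps)
  qed
  show ?thesis
  proof (cases "0 \<le> t")
    case True
    have "(1 + r) powr t \<le> ((1 + m) * (1 + \<bar>r - m\<bar>)) powr t"
      using True assms * by (intro powr_mono2) auto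
    then show ?thesis using True assms by (simp add: powr_mult)
  next
    case False
    have "((1 + r) * (1 + \<bar>m - r\<bar>)) powr t \<le> (1 + m) powr t"
      using False assms * by (intro powr_mono2') (auto intro: add_pos_nonneg)
    then have "(1 + r) powr t * (1 + \<bar>r - m\<bar>) powr t \<le> (1 + m) powr t"
      using assms by (simp add: powr_mult abs_minus_commute)
    then have "(1 + r) powr t * (1 + \<bar>r - m\<bar>) powr t * (1 + \<bar>r - m\<bar>) powr (- t)
        \<le> (1 + m) powr t * (1 + \<bar>r - m\<bar>) powr (- t)"
      by (rule mult_right_mono) simp
    moreover have "1 + \<bar>r - m\<bar> \<noteq> 0" by linarith
    ultimately show ?thesis using False by (simp add: mult.assoc flip: powr_add)
  qed
qed

text \<open>
  The central estimate. The weighted circle mean at radius \<open>r\<close> is controlled by the largest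
  weighted block norm, discounted by a power of the distance from \<open>r\<close> to the block that can be
  prescribed in advance. The constant is chosen before the set, the family and the coefficients,
  and involves the localization constants \<open>K\<close> only through one value.
\<close>
lemma synthesis_block_bound:
  fixes \<alpha> s \<delta> L :: real and K :: "real \<Rightarrow> real" and p :: ennreal
  assumes p: "0 < p" and L: "0 \<le> L" and \<delta>: "0 < \<delta>"
  obtains C where "0 < C"
    "\<And>\<Sigma> \<phi> c r. \<lbrakk>ennreal \<delta> \<le> separation \<Sigma>; localization_constants \<alpha> \<Sigma> \<phi> K; 0 \<le> r\<rbrakk> \<Longrightarrow>
       circle_mean p (synthesis \<Sigma> \<phi> c) r * ennreal (exp (- (\<alpha> / 2) * r\<^sup>2) * (1 + r) powr s)
       \<le> ennreal C * (SUP m. block_norm p (s - recip p) \<Sigma> c m * ennreal ((1 + \<bar>r - real m\<bar>) powr (- L)))"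
proof -
  define \<nu> where "\<nu> = s - recip p"
  define L' where "L' = L + \<bar>\<nu>\<bar>"
  have L': "0 \<le> L'" using L by (simp add: L'_def)
  obtain B N where B: "0 < B" "0 \<le> N" and cm:
    "\<And>\<Sigma> c f E r. \<lbrakk>\<And>m. finite (annulus_part \<Sigma> m); 0 \<le> E; 0 \<le> r;
       \<And>\<theta>. ennreal (cmod (f (rcis r \<theta>))) \<le> ennreal E *
        (SUP \<xi>\<in>\<Sigma>. ennreal (cmod (c \<xi>) * (1 + cmod (rcis r \<theta> - \<xi>)) powr (- N)))\<rbrakk> \<Longrightarrow>
     circle_mean p f r \<le> ennreal (B * E * (1 + r) powr (- recip p)) *
      (SUP m. lp_norm p (annulus_part \<Sigma> m) (\<lambda>\<xi>. ennreal (cmod (c \<xi>))) * ennreal ((1 + \<bar>r - real m\<bar>) powr (- L')))"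
    by (rule circle_mean_block_bound[OF p L']) blast
  obtain C where C: "0 < C" "\<And>F z. \<lbrakk>finite F; \<And>\<xi> \<eta>. \<xi> \<in> F \<Longrightarrow> \<eta> \<in> F \<Longrightarrow> \<xi> \<noteq> \<eta> \<Longrightarrow> \<delta> \<le> cmod (\<xi> - \<eta>)\<rbrakk>
       \<Longrightarrow> (\<Sum>\<xi>\<in>F. (1 + cmod (z - \<xi>)) powr (-4)) \<le> C"
    by (rule separated_sum_bound[OF \<delta>]) blast
  \<comment> \<open>\<open>K\<close> is still arbitrary here, so its value has to be made positive by hand\<close>
  define M where "M = max 1 (K (N + 4))"
  have M: "0 < M" by (simp add: M_def)
  show thesis
  proof (rule that[of "B * M * C"])
    show "0 < B * M * C" using B M C by simp
  next
    fix \<Sigma> \<phi> c and r :: real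
    assume sep: "ennreal \<delta> \<le> separation \<Sigma>" and loc: "localization_constants \<alpha> \<Sigma> \<phi> K" and r: "0 \<le> r"
    define A where "A m = lp_norm p (annulus_part \<Sigma> m) (\<lambda>\<xi>. ennreal (cmod (c \<xi>)))" for m
    define D where "D = (SUP m. block_norm p \<nu> \<Sigma> c m * ennreal ((1 + \<bar>r - real m\<bar>) powr (- L)))"
    define E where "E = exp (\<alpha> / 2 * r\<^sup>2) * M * C"
    have E: "0 \<le> E" using M C by (simp add: E_def)
    have KM: "exp (\<alpha> / 2 * r\<^sup>2) * K (N + 4) * C \<le> E"
      using C(1) unfolding E_def M_def by (intro mult_right_mono mult_left_mono) auto
    have CF: "(\<Sum>\<xi>\<in>F. (1 + cmod (z - \<xi>)) powr (-4)) \<le> C" if "finite F" "F \<subseteq> \<Sigma>" for F z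
      using that le_separationD[OF sep] by (intro C(2)) auto
    have "circle_mean p (synthesis \<Sigma> \<phi> c) r \<le> ennreal (B * E * (1 + r) powr (- recip p)) *
      (SUP m. A m * ennreal ((1 + \<bar>r - real m\<bar>) powr (- L')))"
      unfolding A_def
    proof (rule cm)
      fix \<theta>
      have "ennreal (cmod (synthesis \<Sigma> \<phi> c (rcis r \<theta>))) \<le> ennreal (exp (\<alpha> / 2 * r\<^sup>2) * K (N + 4) * C) *
        (SUP \<xi>\<in>\<Sigma>. ennreal (cmod (c \<xi>) * (1 + cmod (rcis r \<theta> - \<xi>)) powr (- N)))"
        using synthesis_pointwise_bound[OF loc B(2) CF, where z = "rcis r \<theta>" and c = c] r by simp
      also have "\<dots> \<le> ennreal E * (SUP \<xi>\<in>\<Sigma>. ennreal (cmod (c \<xi>) * (1 + cmod (rcis r \<theta> - \<xi>)) powr (- N)))"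
        by (intro mult_right_mono ennreal_leI KM) simp
      finally show "ennreal (cmod (synthesis \<Sigma> \<phi> c (rcis r \<theta>))) \<le> \<dots>" .
    qed (use finite_annulus_part[OF \<delta> sep] E r in auto)
    then have "circle_mean p (synthesis \<Sigma> \<phi> c) r * ennreal (exp (- (\<alpha> / 2) * r\<^sup>2) * (1 + r) powr s)
       \<le> ennreal (B * E * (1 + r) powr (- recip p)) *
      (SUP m. A m * ennreal ((1 + \<bar>r - real m\<bar>) powr (- L'))) * ennreal (exp (- (\<alpha> / 2) * r\<^sup>2) * (1 + r) powr s)"
      by (rule mult_right_mono) simp
    also have "\<dots> = ennreal (B * E * (1 + r) powr (- recip p)) * ennreal (exp (- (\<alpha> / 2) * r\<^sup>2) * (1 + r) powr s) *
      (SUP m. A m * ennreal ((1 + \<bar>r - real m\<bar>) powr (- L')))"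
      by (simp only: mult_ac)
    also have "ennreal (B * E * (1 + r) powr (- recip p)) * ennreal (exp (- (\<alpha> / 2) * r\<^sup>2) * (1 + r) powr s)
        = ennreal (B * M * C) * ennreal ((1 + r) powr \<nu>)"
    proof -
      have "exp (\<alpha> / 2 * r\<^sup>2) * exp (- (\<alpha> / 2) * r\<^sup>2) = 1" by (simp flip: exp_add)
      moreover have "(1 + r) powr \<nu> = (1 + r) powr (- recip p) * (1 + r) powr s"
        by (simp add: \<nu>_def flip: powr_add)
      ultimately have "B * E * (1 + r) powr (- recip p) * (exp (- (\<alpha> / 2) * r\<^sup>2) * (1 + r) powr s)
          = B * M * C * (1 + r) powr \<nu>"
        unfolding E_def by algebra
      then show ?thesis using B(1) M C(1) E by (simp flip: ennreal_mult)
    qed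
    also have "ennreal (B * M * C) * ennreal ((1 + r) powr \<nu>) * (SUP m. A m * ennreal ((1 + \<bar>r - real m\<bar>) powr (- L')))
       = ennreal (B * M * C) * (SUP m. ennreal ((1 + r) powr \<nu>) * (A m * ennreal ((1 + \<bar>r - real m\<bar>) powr (- L'))))"
      by (simp only: mult.assoc SUP_mult_left_ennreal)
    also have "\<dots> \<le> ennreal (B * M * C) * D"
      unfolding D_def
    proof (intro mult_left_mono SUP_mono)
      fix m :: nat
      have "(1 + r) powr \<nu> * (1 + \<bar>r - real m\<bar>) powr (- L')
         \<le> (1 + real m) powr \<nu> * (1 + \<bar>r - real m\<bar>) powr \<bar>\<nu>\<bar> * (1 + \<bar>r - real m\<bar>) powr (- L')"
        by (intro mult_right_mono peetre_inequality r) auto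
      also have "\<dots> = (1 + real m) powr \<nu> * (1 + \<bar>r - real m\<bar>) powr (- L)"
        by (simp add: L'_def mult.assoc flip: powr_add)
      finally have "ennreal ((1 + r) powr \<nu>) * ennreal ((1 + \<bar>r - real m\<bar>) powr (- L'))
          \<le> ennreal ((1 + real m) powr \<nu>) * ennreal ((1 + \<bar>r - real m\<bar>) powr (- L))"
        by (simp add: ennreal_leI flip: ennreal_mult)
      from mult_left_mono[OF this, of "A m"]
      have "ennreal ((1 + r) powr \<nu>) * (A m * ennreal ((1 + \<bar>r - real m\<bar>) powr (- L')))
          \<le> block_norm p \<nu> \<Sigma> c m * ennreal ((1 + \<bar>r - real m\<bar>) powr (- L))"
        by (simp add: block_norm_def A_def mult_ac)
      then show "\<exists>m'\<in>UNIV. ennreal ((1 + r) powr \<nu>) * (A m * ennreal ((1 + \<bar>r - real m\<bar>) powr (- L')))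
          \<le> block_norm p \<nu> \<Sigma> c m' * ennreal ((1 + \<bar>r - real m'\<bar>) powr (- L))" by blast
    qed simp
    finally show "circle_mean p (synthesis \<Sigma> \<phi> c) r * ennreal (exp (- (\<alpha> / 2) * r\<^sup>2) * (1 + r) powr s)
       \<le> ennreal (B * M * C) * (SUP m. block_norm p (s - recip p) \<Sigma> c m * ennreal ((1 + \<bar>r - real m\<bar>) powr (- L)))"
      by (simp only: D_def \<nu>_def)
  qed
qed

text \<open>
  For \<open>q = \<infinity>\<close> the discount is trivial. For finite \<open>q\<close> the factor \<open>r\<close> of the measure is
  absorbed by the extra weight \<open>(1 + r) powr (1 / q)\<close>, the \<open>q\<close>-th power of the supremum is at most
  the sum of the \<open>q\<close>-th powers, and \<open>L = 2 / q\<close> makes the discount of each term integrable in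
  \<open>r\<close> with an integral that does not depend on \<open>m\<close>.
\<close>
lemma fock_norm_le_ell_norm:
  fixes C L \<alpha> \<sigma> :: real
  assumes \<alpha>: "0 < \<alpha>" and q: "0 < q" and C: "0 \<le> C"
    and L: "q = \<infinity> \<Longrightarrow> L = 0" "q \<noteq> \<infinity> \<Longrightarrow> L = 2 / enn2real q"
    and le: "\<And>r. 0 \<le> r \<Longrightarrow> circle_mean p f r * ennreal (exp (- (\<alpha> / 2) * r\<^sup>2) * (1 + r) powr (\<sigma> + recip q))
       \<le> ennreal C * (SUP m. b m * ennreal ((1 + \<bar>r - real m\<bar>) powr (- L)))"
  shows "fock_norm \<alpha> \<sigma> p q f \<le> ennreal ((if q = \<infinity> then 1 else (2 * \<alpha> * enn2real q) powr recip q) * C) * lp_norm q UNIV b"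
proof (cases "q = \<infinity>")
  case True
  have "1 + \<bar>r - real m\<bar> \<noteq> 0" for r m by linarith
  then show ?thesis using True le L by (auto simp: fock_norm_def lp_norm_def intro!: SUP_least)
next
  case False
  define a where "a = enn2real q"
  have a: "0 < a" "recip q = 1 / a" using recip_finite[OF False q] by (auto simp: a_def)
  have L: "L = 2 / a" using L False by (simp add: a_def)
  define g where "g m r = ennreal ((1 + 1 * \<bar>r - real m\<bar>) powr (- 2))" for m r
  have [measurable]: "g m \<in> borel_measurable borel" for m unfolding g_def by measurable
  define S where "S = (\<Sum>\<^sub>\<infinity>m. epow (b m) a)"
  have point: "epow (circle_mean p f r * ennreal ((1 + r) powr \<sigma>)) a * ennreal (exp (- (\<alpha> * a / 2) * r\<^sup>2) * r)
      \<le> ennreal (C powr a) * (\<Sum>m. epow (b m) a * g m r)" (is "?l \<le> _ * ?W") if r: "0 \<le> r" for r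
  proof -
    have "?l \<le> epow (circle_mean p f r * ennreal ((1 + r) powr \<sigma>)) a * epow (ennreal (exp (- (\<alpha> / 2) * r\<^sup>2) * (1 + r) powr (1 / a))) a"
    proof (intro mult_left_mono)
      have "exp (- (\<alpha> * a / 2) * r\<^sup>2) * r \<le> (exp (- (\<alpha> / 2) * r\<^sup>2) * (1 + r) powr (1 / a)) powr a"
        using a r by (simp add: powr_mult powr_powr exp_powr_real mult_ac)
      then show "ennreal (exp (- (\<alpha> * a / 2) * r\<^sup>2) * r) \<le> epow (ennreal (exp (- (\<alpha> / 2) * r\<^sup>2) * (1 + r) powr (1 / a))) a"
        by (simp add: epow_ennreal ennreal_leI)
    qed simp
    also have "\<dots> = epow (circle_mean p f r * (ennreal ((1 + r) powr \<sigma>) * ennreal (exp (- (\<alpha> / 2) * r\<^sup>2) * (1 + r) powr (1 / a)))) a"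
      using a by (simp add: epow_mult mult_ac)
    also have "ennreal ((1 + r) powr \<sigma>) * ennreal (exp (- (\<alpha> / 2) * r\<^sup>2) * (1 + r) powr (1 / a))
         = ennreal (exp (- (\<alpha> / 2) * r\<^sup>2) * (1 + r) powr (\<sigma> + recip q))"
      by (simp add: a powr_add mult_ac flip: ennreal_mult)
    also have "epow (circle_mean p f r * \<dots>) a
       \<le> epow (ennreal C * (SUP m. b m * ennreal ((1 + \<bar>r - real m\<bar>) powr (- L)))) a"
      using a le[OF r] by (intro epow_mono) auto
    also have "\<dots> \<le> epow (ennreal C * epow ?W (1 / a)) a"
    proof (intro epow_mono a mult_left_mono SUP_least)
      fix m :: nat
      have "b m * ennreal ((1 + \<bar>r - real m\<bar>) powr (- L)) =
         epow (epow (b m * ennreal ((1 + \<bar>r - real m\<bar>) powr (- L))) a) (1 / a)"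
        using a by (simp add: epow_inverse)
      also have "epow (b m * ennreal ((1 + \<bar>r - real m\<bar>) powr (- L))) a = epow (b m) a * g m r"
        using a by (simp add: epow_mult epow_ennreal powr_powr g_def L)
      also have "epow \<dots> (1 / a) \<le> epow ?W (1 / a)"
        using a sum_le_suminf[of "\<lambda>m. epow (b m) a * g m r" "{m}"] by (intro epow_mono) auto
      finally show "b m * ennreal ((1 + \<bar>r - real m\<bar>) powr (- L)) \<le> epow ?W (1 / a)" .
    qed simp
    also have "\<dots> = ennreal (C powr a) * ?W"
      using a C by (simp add: epow_mult epow_inverse epow_ennreal)
    finally show ?thesis .
  qed
  have "(\<integral>\<^sup>+r\<in>{0..}. epow (circle_mean p f r * ennreal ((1 + r) powr \<sigma>)) a * ennreal (exp (- (\<alpha> * a / 2) * r\<^sup>2) * r) \<partial>lborel)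
     \<le> (\<integral>\<^sup>+r. ennreal (C powr a) * (\<Sum>m. epow (b m) a * g m r) \<partial>lborel)"
    using point by (intro nn_integral_mono) (auto simp: indicator_def)
  also have "\<dots> = ennreal (C powr a) * (\<Sum>m. epow (b m) a * (\<integral>\<^sup>+r. g m r \<partial>lborel))"
    by (simp add: nn_integral_cmult nn_integral_suminf)
  also have "\<dots> \<le> ennreal (C powr a) * (\<Sum>m. epow (b m) a * ennreal (2 / 1))"
    unfolding g_def by (intro mult_left_mono suminf_le nn_integral_inverse_square) auto
  also have "\<dots> \<le> ennreal (C powr a) * (S * ennreal 2)"
    unfolding S_def using suminf_le_infsum_ennreal[of "\<lambda>m. epow (b m) a"]
    by (simp add: mult_left_mono mult_right_mono)
  finally have "ennreal (\<alpha> * a) * (\<integral>\<^sup>+r\<in>{0..}. epow (circle_mean p f r * ennreal ((1 + r) powr \<sigma>)) a * ennreal (exp (- (\<alpha> * a / 2) * r\<^sup>2) * r) \<partial>lborel)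
     \<le> ennreal (\<alpha> * a) * (ennreal (C powr a) * (S * ennreal 2))"
    by (rule mult_left_mono) simp
  then have "fock_norm \<alpha> \<sigma> p q f \<le> epow (ennreal (\<alpha> * a) * (ennreal (C powr a) * (S * ennreal 2))) (1 / a)"
    unfolding fock_norm_def using False a by (auto simp flip: a_def intro!: epow_mono)
  also have "ennreal (\<alpha> * a) * (ennreal (C powr a) * (S * ennreal 2)) = ennreal (2 * \<alpha> * a * C powr a) * S"
  proof -
    have "ennreal (2 * \<alpha> * a * C powr a) = ennreal (\<alpha> * a) * ennreal (C powr a) * ennreal 2"
      using \<alpha> a C by (simp add: mult_ac del: ennreal_numeral flip: ennreal_mult)
    then show ?thesis by (simp only: mult_ac)
  qed
  also have "epow \<dots> (1 / a) = ennreal ((2 * \<alpha> * a) powr (1 / a) * C) * lp_norm q UNIV b"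
    using a \<alpha> C False by (simp add: epow_mult epow_ennreal powr_mult powr_powr lp_norm_def S_def flip: a_def)
  finally show ?thesis using False a by (simp flip: a_def)
qed

text \<open>
  Late blocks are small by themselves; the finitely many early ones are discounted more and more
  as \<open>r\<close> grows.
\<close>
lemma SUP_shifted_decay_tendsto_0:
  fixes b :: "nat \<Rightarrow> ennreal"
  assumes lim: "b \<longlonglongrightarrow> 0" and bdd: "(SUP m. b m) < \<infinity>"
  shows "((\<lambda>r. SUP m. b m * ennreal ((1 + \<bar>r - real m\<bar>) powr (- 1))) \<longlongrightarrow> 0) at_top"
proof (rule order_tendstoI)
  fix e :: ennreal assume e: "0 < e"
  obtain e' where e': "0 < e'" "e' < e" using dense[OF e] by blast
  obtain S where S: "(SUP m. b m) = ennreal S" "0 \<le> S" using bdd by (cases "SUP m. b m") auto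
  obtain M where M: "\<And>m. M \<le> m \<Longrightarrow> b m < e'"
    using order_tendstoD(2)[OF lim e'(1)] by (auto simp: eventually_sequentially)
  have "((\<lambda>r. ennreal (S * (1 + (r - real M)) powr (- 1))) \<longlongrightarrow> ennreal 0) at_top"
    by (intro tendsto_ennrealI) real_asymp
  then have "eventually (\<lambda>r. ennreal (S * (1 + (r - real M)) powr (- 1)) < e') at_top"
    using e'(1) by (intro order_tendstoD(2)[where y = 0]) auto
  then show "eventually (\<lambda>r. (SUP m. b m * ennreal ((1 + \<bar>r - real m\<bar>) powr (- 1))) < e) at_top"
    using eventually_ge_at_top[of "real M"]
  proof eventually_elim
    case (elim r)
    have "(SUP m. b m * ennreal ((1 + \<bar>r - real m\<bar>) powr (- 1))) \<le> e'"
    proof (rule SUP_least)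
      fix m
      show "b m * ennreal ((1 + \<bar>r - real m\<bar>) powr (- 1)) \<le> e'"
      proof (cases "M \<le> m")
        case True
        have "(1 + \<bar>r - real m\<bar>) powr (- 1) \<le> 1"
          by (simp add: powr_minus inverse_le_1_iff)
        then have "b m * ennreal ((1 + \<bar>r - real m\<bar>) powr (- 1)) \<le> e' * 1"
          using M[OF True] by (intro mult_mono) (auto simp: ennreal_le_1)
        then show ?thesis by simp
      next
        case False
        then have "(1 + \<bar>r - real m\<bar>) powr (- 1) \<le> (1 + (r - real M)) powr (- 1)"
          using elim by (intro powr_mono2') auto
        moreover have "b m \<le> ennreal S" unfolding S(1)[symmetric] by (rule SUP_upper) simp
        ultimately have "b m * ennreal ((1 + \<bar>r - real m\<bar>) powr (- 1)) \<le> ennreal S * ennreal ((1 + (r - real M)) powr (- 1))"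
          by (intro mult_mono ennreal_leI) auto
        also have "\<dots> \<le> e'" using elim S(2) by (simp flip: ennreal_mult)
        finally show ?thesis .
      qed
    qed
    then show ?case using e'(2) by simp
  qed
qed simp

section \<open>Convergence of the synthesis series\<close>

text \<open>
  Every weighted sequence space embeds into the one with \<open>p = q = \<infinity>\<close> and the same weight.
\<close>
lemma ell_space_polynomial_growth:
  assumes p: "0 < p" and q: "0 < q" and c: "c \<in> ell_space p q \<nu> \<Sigma>"
  obtains A where "0 \<le> A" "\<And>\<xi>. \<xi> \<in> \<Sigma> \<Longrightarrow> cmod (c \<xi>) \<le> A * (1 + cmod \<xi>) powr \<bar>\<nu>\<bar>"
proof -
  obtain A where A: "ell_norm p q \<nu> \<Sigma> c = ennreal A" "0 \<le> A"
    using c unfolding ell_space_def by (cases "ell_norm p q \<nu> \<Sigma> c") auto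
  have "cmod (c \<xi>) \<le> A * (1 + cmod \<xi>) powr \<bar>\<nu>\<bar>" if \<xi>: "\<xi> \<in> \<Sigma>" for \<xi>
  proof -
    obtain m where m: "\<xi> \<in> annulus_part \<Sigma> m" using \<xi> by (rule annulus_part_cover)
    have "ennreal ((1 + real m) powr \<nu>) * ennreal (cmod (c \<xi>)) \<le> block_norm p \<nu> \<Sigma> c m"
      unfolding block_norm_def using p m
      by (intro mult_left_mono lp_norm_ge[where x = "\<lambda>\<xi>. ennreal (cmod (c \<xi>))"]) auto
    also have "\<dots> \<le> ennreal A"
      unfolding A(1)[symmetric] ell_norm_def using q by (intro lp_norm_ge) auto
    finally have "(1 + real m) powr \<nu> * cmod (c \<xi>) \<le> A"
      using A(2) by (simp flip: ennreal_mult)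
    then have "(1 + real m) powr (- \<nu>) * ((1 + real m) powr \<nu> * cmod (c \<xi>)) \<le> (1 + real m) powr (- \<nu>) * A"
      by (rule mult_left_mono) simp
    moreover have "1 + real m \<noteq> 0" by linarith
    ultimately have "cmod (c \<xi>) \<le> (1 + real m) powr (- \<nu>) * A"
      by (simp add: mult.assoc[symmetric] flip: powr_add)
    also have "\<dots> \<le> (1 + cmod \<xi>) powr \<bar>\<nu>\<bar> * A"
    proof (intro mult_right_mono A(2))
      have "(1 + real m) powr (- \<nu>) \<le> (1 + real m) powr \<bar>\<nu>\<bar>" by (intro powr_mono) auto
      also have "\<dots> \<le> (1 + cmod \<xi>) powr \<bar>\<nu>\<bar>"
        using m by (intro powr_mono2) (auto simp: annulus_part_def)
      finally show "(1 + real m) powr (- \<nu>) \<le> (1 + cmod \<xi>) powr \<bar>\<nu>\<bar>" .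
    qed
    finally show ?thesis by (simp add: mult.commute)
  qed
  with A(2) show thesis by (rule that)
qed

text \<open>
  Polynomial growth of the coefficients loses against rapid localization: the exponent
  \<open>t + 4\<close> compensates the growth and leaves a weight that is summable over \<open>\<Sigma>\<close>. For \<open>z\<close> in a
  bounded set, the decay in \<open>z - \<xi>\<close> is decay in \<open>\<xi>\<close>.
\<close>
lemma synthesis_local_majorant:
  assumes \<alpha>: "0 \<le> \<alpha>" and \<delta>: "0 < \<delta>" and sep: "ennreal \<delta> \<le> separation \<Sigma>"
    and loc: "localization_constants \<alpha> \<Sigma> \<phi> K"
    and A: "0 \<le> A" "0 \<le> t" "\<And>\<xi>. \<xi> \<in> \<Sigma> \<Longrightarrow> cmod (c \<xi>) \<le> A * (1 + cmod \<xi>) powr t"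
    and R: "0 \<le> R"
  obtains M where "M summable_on \<Sigma>" "\<And>\<xi> z. \<xi> \<in> \<Sigma> \<Longrightarrow> cmod z \<le> R \<Longrightarrow> norm (c \<xi> * \<phi> \<xi> z) \<le> M \<xi>"
proof -
  define N where "N = t + 4"
  define B where "B = A * (exp (\<alpha> / 2 * R\<^sup>2) * K N * (1 + R) powr N)"
  have N: "0 < N" using A(2) by (simp add: N_def)
  have KN: "0 < K N" using loc N unfolding localization_constants_def by blast
  obtain C where C: "0 < C" "\<And>F z. \<lbrakk>finite F; \<And>\<xi> \<eta>. \<xi> \<in> F \<Longrightarrow> \<eta> \<in> F \<Longrightarrow> \<xi> \<noteq> \<eta> \<Longrightarrow> \<delta> \<le> cmod (\<xi> - \<eta>)\<rbrakk>
       \<Longrightarrow> (\<Sum>\<xi>\<in>F. (1 + cmod (z - \<xi>)) powr (-4)) \<le> C"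
    by (rule separated_sum_bound[OF \<delta>]) blast
  have "(\<Sum>\<xi>\<in>F. (1 + cmod \<xi>) powr (-4)) \<le> C" if "finite F" "F \<subseteq> \<Sigma>" for F
    using C(2)[of F 0] le_separationD[OF sep] that by (auto simp: subset_iff)
  then have "(\<lambda>\<xi>. (1 + cmod \<xi>) powr (-4)) summable_on \<Sigma>"
    by (intro nonneg_bdd_above_summable_on bdd_aboveI2[where M = C]) auto
  then have "(\<lambda>\<xi>. B * (1 + cmod \<xi>) powr (-4)) summable_on \<Sigma>" by (rule summable_on_cmult_right)
  moreover have "norm (c \<xi> * \<phi> \<xi> z) \<le> B * (1 + cmod \<xi>) powr (-4)" if \<xi>: "\<xi> \<in> \<Sigma>" and z: "cmod z \<le> R" for \<xi> z
  proof -
    have "cmod \<xi> \<le> cmod z + cmod (z - \<xi>)" by (metis norm_triangle_sub norm_minus_commute)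
    moreover have "0 \<le> R * cmod (z - \<xi>)" using R by simp
    ultimately have "1 + cmod \<xi> \<le> (1 + R) * (1 + cmod (z - \<xi>))"
      using z by (simp add: algebra_simps)
    then have "(1 + cmod \<xi>) / (1 + R) \<le> 1 + cmod (z - \<xi>)" using R by (simp add: field_simps)
    then have "(1 + cmod (z - \<xi>)) powr (- N) \<le> ((1 + cmod \<xi>) / (1 + R)) powr (- N)"
      using N R by (intro powr_mono2') (auto intro!: divide_pos_pos add_pos_nonneg)
    also have "\<dots> = (1 + R) powr N * (1 + cmod \<xi>) powr (- N)"
      using R by (simp add: powr_divide powr_minus field_simps)
    finally have w: "(1 + cmod (z - \<xi>)) powr (- N) \<le> (1 + R) powr N * (1 + cmod \<xi>) powr (- N)" .
    have "cmod (\<phi> \<xi> z) \<le> exp (\<alpha> / 2 * (cmod z)\<^sup>2) * K N * (1 + cmod (z - \<xi>)) powr (- N)"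
      by (rule localization_constantsD[OF loc N \<xi>])
    also have "\<dots> \<le> exp (\<alpha> / 2 * R\<^sup>2) * K N * ((1 + R) powr N * (1 + cmod \<xi>) powr (- N))"
      using KN \<alpha> z w by (intro mult_mono) (auto intro!: mult_left_mono power_mono)
    finally have "cmod (c \<xi>) * cmod (\<phi> \<xi> z) \<le> A * (1 + cmod \<xi>) powr t * 
         (exp (\<alpha> / 2 * R\<^sup>2) * K N * ((1 + R) powr N * (1 + cmod \<xi>) powr (- N)))"
      using A(1) A(3)[OF \<xi>] by (intro mult_mono) auto
    also have "\<dots> = B * ((1 + cmod \<xi>) powr t * (1 + cmod \<xi>) powr (- N))"
      by (simp add: B_def mult_ac)
    also have "(1 + cmod \<xi>) powr t * (1 + cmod \<xi>) powr (- N) = (1 + cmod \<xi>) powr (-4)"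
      by (simp add: N_def flip: powr_add)
    finally show ?thesis by (simp add: norm_mult)
  qed
  ultimately show thesis by (rule that)
qed

lemma synthesis_converges_if_majorized:
  assumes "\<And>R. 0 \<le> R \<Longrightarrow> \<exists>M. M summable_on \<Sigma> \<and> (\<forall>\<xi>\<in>\<Sigma>. \<forall>z. cmod z \<le> R \<longrightarrow> norm (c \<xi> * \<phi> \<xi> z) \<le> M \<xi>)"
  shows "synthesis_converges \<Sigma> \<phi> c"
  unfolding synthesis_converges_def
proof (intro conjI allI impI)
  fix z
  obtain M where M: "M summable_on \<Sigma>" "\<And>\<xi>. \<xi> \<in> \<Sigma> \<Longrightarrow> norm (c \<xi> * \<phi> \<xi> z) \<le> M \<xi>"
    using assms[of "cmod z"] by auto
  then show "(\<lambda>\<xi>. norm (c \<xi> * \<phi> \<xi> z)) summable_on \<Sigma>" by (rule Infinite_Sum.abs_summable_on_comparison_test')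
next
  fix B :: "complex set" assume "compact B"
  then have "bounded B" by (rule compact_imp_bounded)
  then obtain R where R: "0 < R" "\<And>z. z \<in> B \<Longrightarrow> cmod z \<le> R"
    unfolding bounded_pos by blast
  obtain M where M: "M summable_on \<Sigma>" "\<And>\<xi> z. \<xi> \<in> \<Sigma> \<Longrightarrow> cmod z \<le> R \<Longrightarrow> norm (c \<xi> * \<phi> \<xi> z) \<le> M \<xi>"
    using assms[of R] R by auto
  show "uniform_limit B (\<lambda>F z. \<Sum>\<xi>\<in>F. c \<xi> * \<phi> \<xi> z) (synthesis \<Sigma> \<phi> c) (finite_subsets_at_top \<Sigma>)"
    unfolding synthesis_def using R M by (intro Weierstrass_m_test_general[where M = M]) auto
qed

lemma synthesis_holomorphic:
  assumes conv: "synthesis_converges \<Sigma> \<phi> c" and hol: "\<And>\<xi>. \<xi> \<in> \<Sigma> \<Longrightarrow> \<phi> \<xi> holomorphic_on UNIV"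
  shows "synthesis \<Sigma> \<phi> c holomorphic_on UNIV"
proof -
  have "synthesis \<Sigma> \<phi> c field_differentiable at z" for z
  proof -
    have lim: "uniform_limit (cball z 1) (\<lambda>F z. \<Sum>\<xi>\<in>F. c \<xi> * \<phi> \<xi> z) (synthesis \<Sigma> \<phi> c) (finite_subsets_at_top \<Sigma>)"
      using conv compact_cball unfolding synthesis_converges_def by simp
    have sum: "(\<lambda>z. \<Sum>\<xi>\<in>F. c \<xi> * \<phi> \<xi> z) holomorphic_on S" if "F \<subseteq> \<Sigma>" for F S
      using that hol by (intro holomorphic_intros) (auto intro: holomorphic_on_subset)
    have "\<forall>\<^sub>F F in finite_subsets_at_top \<Sigma>. continuous_on (cball z 1) (\<lambda>z. \<Sum>\<xi>\<in>F. c \<xi> * \<phi> \<xi> z) \<and>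
        (\<lambda>z. \<Sum>\<xi>\<in>F. c \<xi> * \<phi> \<xi> z) holomorphic_on ball z 1"
      by (intro eventually_finite_subsets_at_top_weakI conjI holomorphic_on_imp_continuous_on sum)
    then have "synthesis \<Sigma> \<phi> c holomorphic_on ball z 1"
      by (rule holomorphic_uniform_limit[OF _ lim]) auto
    then show ?thesis by (rule holomorphic_on_imp_differentiable_at) auto
  qed
  then show ?thesis by (simp add: holomorphic_on_def field_differentiable_at_within)
qed

section \<open>Boundedness of the synthesis operator\<close>

lemma synthesis_norm_bound:
  fixes \<alpha> \<sigma> \<delta> :: real and p q :: ennreal and K :: "real \<Rightarrow> real"
  assumes "0 < \<alpha>" "0 < p" "0 < q" "0 < \<delta>"
  obtains C where "0 < C"
    "\<And>\<Sigma> \<phi> c. \<lbrakk>ennreal \<delta> \<le> separation \<Sigma>; localization_constants \<alpha> \<Sigma> \<phi> K\<rbrakk> \<Longrightarrow>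
      fock_norm \<alpha> \<sigma> p q (synthesis \<Sigma> \<phi> c) \<le> ennreal C * ell_nat_norm \<sigma> p q \<Sigma> c"
proof -
  define L where "L = (if q = \<infinity> then 0 else 2 / enn2real q)"
  define D where "D = (if q = \<infinity> then 1 else (2 * \<alpha> * enn2real q) powr recip q)"
  have L: "0 \<le> L" and D: "0 < D"
    using recip_finite[OF _ assms(3)] assms(1) by (auto simp: L_def D_def)
  obtain C where C: "0 < C"
    "\<And>\<Sigma> \<phi> c r. \<lbrakk>ennreal \<delta> \<le> separation \<Sigma>; localization_constants \<alpha> \<Sigma> \<phi> K; 0 \<le> r\<rbrakk> \<Longrightarrow>
       circle_mean p (synthesis \<Sigma> \<phi> c) r * ennreal (exp (- (\<alpha> / 2) * r\<^sup>2) * (1 + r) powr (\<sigma> + recip q))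
       \<le> ennreal C * (SUP m. block_norm p (\<sigma> + recip q - recip p) \<Sigma> c m * ennreal ((1 + \<bar>r - real m\<bar>) powr (- L)))"
    by (rule synthesis_block_bound[OF assms(2) L assms(4)]) blast
  have \<nu>: "recip q - recip p + \<sigma> = \<sigma> + recip q - recip p" by simp
  show thesis
  proof (rule that[of "D * C"])
    show "0 < D * C" using C D by simp
    show "fock_norm \<alpha> \<sigma> p q (synthesis \<Sigma> \<phi> c) \<le> ennreal (D * C) * ell_nat_norm \<sigma> p q \<Sigma> c"
      if "ennreal \<delta> \<le> separation \<Sigma>" "localization_constants \<alpha> \<Sigma> \<phi> K" for \<Sigma> \<phi> c
      unfolding ell_nat_norm_def ell_norm_def \<nu> D_def
      by (rule fock_norm_le_ell_norm[OF assms(1,3) less_imp_le[OF C(1)] _ _ C(2)[OF that]])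
        (auto simp: L_def)
  qed
qed

theorem theorem2p5:
  fixes \<alpha> \<sigma> :: real and p q :: ennreal
  assumes "0 < \<alpha>" and "0 < p" and "0 < q"
  shows "\<exists>C :: real \<Rightarrow> (real \<Rightarrow> real) \<Rightarrow> real.
    (\<forall>\<delta> K. 0 < C \<delta> K) \<and>
    (\<forall>(\<Sigma> :: complex set) (\<phi> :: complex \<Rightarrow> complex \<Rightarrow> complex).
       separated_set \<Sigma> \<and> rapidly_fock_localized \<alpha> \<Sigma> \<phi> \<longrightarrow>
       (\<forall>c \<in> ell_nat \<sigma> p q \<Sigma>.
          synthesis_converges \<Sigma> \<phi> c \<and>
          synthesis \<Sigma> \<phi> c \<in> fock_space \<alpha> \<sigma> p q \<and>
          (\<forall>\<delta> K. 0 < \<delta> \<and> ennreal \<delta> \<le> separation \<Sigma> \<and> localization_constants \<alpha> \<Sigma> \<phi> K \<longrightarrow>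
             fock_norm \<alpha> \<sigma> p q (synthesis \<Sigma> \<phi> c)
               \<le> ennreal (C \<delta> K) * ell_nat_norm \<sigma> p q \<Sigma> c)) \<and>
       (q = \<infinity> \<longrightarrow>
          (\<forall>c \<in> ell_nat_0 \<sigma> p \<Sigma>.
             ((\<lambda>r. ennreal ((1 + r) powr \<sigma>) * circle_mean p (synthesis \<Sigma> \<phi> c) r *
                   ennreal (exp (- (\<alpha> / 2) * r\<^sup>2))) \<longlongrightarrow> 0) at_top)))"
proof -
  have "\<exists>C>0. 0 < \<delta> \<longrightarrow> (\<forall>\<Sigma> \<phi> c. ennreal \<delta> \<le> separation \<Sigma> \<longrightarrow> localization_constants \<alpha> \<Sigma> \<phi> K \<longrightarrow>
      fock_norm \<alpha> \<sigma> p q (synthesis \<Sigma> \<phi> c) \<le> ennreal C * ell_nat_norm \<sigma> p q \<Sigma> c)" for \<delta> :: real and K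
  proof (cases "0 < \<delta>")
    case True
    show ?thesis by (rule synthesis_norm_bound[OF assms True, of K \<sigma>]) blast
  qed (auto intro: exI[of _ 1])
  then obtain C :: "real \<Rightarrow> (real \<Rightarrow> real) \<Rightarrow> real" where C0: "\<And>\<delta> K. 0 < C \<delta> K"
    and C: "\<And>\<delta> K \<Sigma> \<phi> c. \<lbrakk>0 < \<delta>; ennreal \<delta> \<le> separation \<Sigma>; localization_constants \<alpha> \<Sigma> \<phi> K\<rbrakk> \<Longrightarrow>
      fock_norm \<alpha> \<sigma> p q (synthesis \<Sigma> \<phi> c) \<le> ennreal (C \<delta> K) * ell_nat_norm \<sigma> p q \<Sigma> c"
    by metis
  show ?thesis
  proof (intro exI[of _ C] conjI allI ballI impI)
    show "0 < C \<delta> K" for \<delta> K by (rule C0)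
  next
    fix \<Sigma> \<phi> c \<delta> K
    assume "0 < \<delta> \<and> ennreal \<delta> \<le> separation \<Sigma> \<and> localization_constants \<alpha> \<Sigma> \<phi> K"
    then show "fock_norm \<alpha> \<sigma> p q (synthesis \<Sigma> \<phi> c) \<le> ennreal (C \<delta> K) * ell_nat_norm \<sigma> p q \<Sigma> c"
      by (intro C) auto
  next
    fix \<Sigma> \<phi>
    assume *: "separated_set \<Sigma> \<and> rapidly_fock_localized \<alpha> \<Sigma> \<phi>"
    obtain K where K: "localization_constants \<alpha> \<Sigma> \<phi> K"
      using * unfolding rapidly_fock_localized_def by blast
    have hol: "\<And>\<xi>. \<xi> \<in> \<Sigma> \<Longrightarrow> \<phi> \<xi> holomorphic_on UNIV"
      using * unfolding rapidly_fock_localized_def by blast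
    obtain \<delta> where \<delta>: "0 < \<delta>" "ennreal \<delta> \<le> separation \<Sigma>"
    proof -
      have "0 < separation \<Sigma>" using * unfolding separated_set_def by blast
      then obtain e where e: "0 < e" "e < separation \<Sigma>" using dense by blast
      then show thesis
        by (cases e) (auto intro: that)
    qed
    fix c
    {
      assume c: "c \<in> ell_nat \<sigma> p q \<Sigma>"
      obtain A where A: "0 \<le> A" "\<And>\<xi>. \<xi> \<in> \<Sigma> \<Longrightarrow> cmod (c \<xi>) \<le> A * (1 + cmod \<xi>) powr \<bar>recip q - recip p + \<sigma>\<bar>"
        using c ell_space_polynomial_growth[OF assms(2,3)] unfolding ell_nat_def by blast
      have maj: "\<exists>M. M summable_on \<Sigma> \<and> (\<forall>\<xi>\<in>\<Sigma>. \<forall>z. cmod z \<le> R \<longrightarrow> norm (c \<xi> * \<phi> \<xi> z) \<le> M \<xi>)"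
        if "0 \<le> R" for R
        using synthesis_local_majorant[OF less_imp_le[OF assms(1)] \<delta> K A(1) abs_ge_zero A(2) that] by metis
      then show conv: "synthesis_converges \<Sigma> \<phi> c" by (rule synthesis_converges_if_majorized)
      have "fock_norm \<alpha> \<sigma> p q (synthesis \<Sigma> \<phi> c) \<le> ennreal (C \<delta> K) * ell_nat_norm \<sigma> p q \<Sigma> c"
        by (intro C \<delta> K)
      also have "\<dots> < \<infinity>"
        using c by (simp add: ell_nat_def ell_space_def ell_nat_norm_def ennreal_mult_less_top)
      finally show "synthesis \<Sigma> \<phi> c \<in> fock_space \<alpha> \<sigma> p q"
        using synthesis_holomorphic[OF conv hol] by (simp add: fock_space_def)
    next
      assume c: "c \<in> ell_nat_0 \<sigma> p \<Sigma>"
      define D where "D r = (SUP m. block_norm p (\<sigma> - recip p) \<Sigma> c m * ennreal ((1 + \<bar>r - real m\<bar>) powr (- 1)))" for r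
      obtain B where B: "\<And>\<Sigma> \<phi> c r. \<lbrakk>ennreal \<delta> \<le> separation \<Sigma>; localization_constants \<alpha> \<Sigma> \<phi> K; 0 \<le> r\<rbrakk> \<Longrightarrow>
         circle_mean p (synthesis \<Sigma> \<phi> c) r * ennreal (exp (- (\<alpha> / 2) * r\<^sup>2) * (1 + r) powr \<sigma>)
         \<le> ennreal B * (SUP m. block_norm p (\<sigma> - recip p) \<Sigma> c m * ennreal ((1 + \<bar>r - real m\<bar>) powr (- 1)))"
        by (rule synthesis_block_bound[OF assms(2) zero_le_one \<delta>(1)]) blast
      have \<nu>: "- recip p + \<sigma> = \<sigma> - recip p" by simp
      have "(D \<longlongrightarrow> 0) at_top"
        unfolding D_def using c
        by (intro SUP_shifted_decay_tendsto_0)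
          (auto simp: ell_nat_0_def ell_space_0_def ell_space_def ell_norm_def lp_norm_def \<nu>)
      then have lim: "((\<lambda>r. ennreal B * D r) \<longlongrightarrow> 0) at_top"
        using ennreal_tendsto_cmult[of "ennreal B" D 0 at_top] by simp
      show "((\<lambda>r. ennreal ((1 + r) powr \<sigma>) * circle_mean p (synthesis \<Sigma> \<phi> c) r *
                   ennreal (exp (- (\<alpha> / 2) * r\<^sup>2))) \<longlongrightarrow> 0) at_top"
      proof (rule tendsto_sandwich[OF _ _ tendsto_const lim])
        show "\<forall>\<^sub>F r in at_top. ennreal ((1 + r) powr \<sigma>) * circle_mean p (synthesis \<Sigma> \<phi> c) r *
                   ennreal (exp (- (\<alpha> / 2) * r\<^sup>2)) \<le> ennreal B * D r"
          using eventually_ge_at_top[of 0]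
        proof eventually_elim
          case (elim r)
          have "ennreal ((1 + r) powr \<sigma>) * circle_mean p (synthesis \<Sigma> \<phi> c) r * ennreal (exp (- (\<alpha> / 2) * r\<^sup>2))
            = circle_mean p (synthesis \<Sigma> \<phi> c) r * ennreal (exp (- (\<alpha> / 2) * r\<^sup>2) * (1 + r) powr \<sigma>)"
            by (simp add: ennreal_mult mult_ac)
          then show ?case using B[OF \<delta>(2) K elim] by (simp only: D_def)
        qed
      qed simp
    }
  qed
qed

end
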